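(* Let $\mathcal{A}$ be a $C^*$-algebra, let $X$ be a semi-inner product module over $\mathcal{A}$, let $a,b\in X$, and let $\overline{p}=(p_1,\dots,p_n)\in\mathbb{R}^n$ be a probability vector. If $\overline{x}=(x_1,\dots,x_n)\in X^n$ and $\overline{y}=(y_1,\dots,y_n)\in X^n$, then the following inequalities hold in $\mathcal{A}$: $$\left|\sum_{i=1}^n p_i\langle x_i,y_i\rangle-\left\langle\sum_{i=1}^n p_ix_i,\sum_{i=1}^n p_iy_i\right\rangle\right|^2 \leq\left\|\sum_{i=1}^n p_i|x_i-a|^2-\left|\sum_{i=1}^n p_ix_i-a\right|^2\right\|\left(\sum_{i=1}^n p_i|y_i-b|^2-\left|\sum_{i=1}^n p_iy_i-b\right|^2\right)$$ $$\leq\left(\sum_{i=1}^n p_i\|x_i-a\|^2\right)\left(\sum_{i=1}^n p_i|y_i-b|^2\right).$$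
   Context: A semi-inner product module over a $C^*$-algebra $\mathcal{A}$ (a semi-inner product $C^*$-module) is a right $\mathcal{A}$-module $X$ (as usual, a complex vector space whose scalar multiplication is compatible with the $\mathcal{A}$-action) with a map $\langle\cdot,\cdot\rangle:X\times X\to\mathcal{A}$ such that (i) $\langle x,y+z\rangle=\langle x,y\rangle+\langle x,z\rangle$; (ii) $\langle x,ya\rangle=\langle x,y\rangle a$; (iii) $\langle x,y\rangle^*=\langle y,x\rangle$; (iv) $\langle x,x\rangle\ge 0$, for all $x,y,z\in X$, $a\in\mathcal{A}$. For $x\in X$, $|x|=\langle x,x\rangle^{1/2}\in\mathcal{A}$ and $\|x\|=\|\langle x,x\rangle\|^{1/2}$; for $a\in\mathcal{A}$, $|a|=(a^*a)^{1/2}$. The order $\le$ is the usual order on self-adjoint elements of $\mathcal{A}$. A probability vector is $\overline{p}=(p_1,\dots,p_n)\in\mathbb{R}^n$ with $p_i\ge 0$ for all $i$ and $\sum_{i=1}^n p_i=1$. *)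

theory Defs
  imports Complex_Main
begin

class complex_vector = real_vector +
  fixes scaleC :: "complex \<Rightarrow> 'a \<Rightarrow> 'a"  (infixr "*\<^sub>C" 75)
  assumes scaleC_add_right: "c *\<^sub>C (x + y) = c *\<^sub>C x + c *\<^sub>C y"
    and scaleC_add_left: "(c + d) *\<^sub>C x = c *\<^sub>C x + d *\<^sub>C x"
    and scaleC_scaleC: "c *\<^sub>C (d *\<^sub>C x) = (c * d) *\<^sub>C x"
    and scaleC_one: "1 *\<^sub>C x = x"
    and scaleR_scaleC: "r *\<^sub>R x = complex_of_real r *\<^sub>C x"

text \<open>Neither a unit nor non-triviality of the algebra is required.\<close>

class cstar_algebra = complex_vector + real_normed_algebra + banach +
  fixes star :: "'a \<Rightarrow> 'a"
  assumes scaleC_mult_left: "(c *\<^sub>C x) * y = c *\<^sub>C (x * y)"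
    and scaleC_mult_right: "x * (c *\<^sub>C y) = c *\<^sub>C (x * y)"
    and norm_scaleC: "norm (c *\<^sub>C x) = cmod c * norm x"
    and star_add: "star (x + y) = star x + star y"
    and star_scaleC: "star (c *\<^sub>C x) = cnj c *\<^sub>C star x"
    and star_mult: "star (x * y) = star y * star x"
    and star_star: "star (star x) = x"
    and cstar_identity: "norm (star x * x) = (norm x)\<^sup>2"

definition selfadjoint :: "'a::cstar_algebra \<Rightarrow> bool" where
  "selfadjoint a \<longleftrightarrow> star a = a"

text \<open>The pair \<open>(a, \<alpha>)\<close> stands for the element \<open>a + \<alpha>1\<close> of the unitization, whose unit is \<open>(0, 1)\<close>.\<close>

definition unitization_mult ::
    "'a::cstar_algebra \<times> complex \<Rightarrow> 'a \<times> complex \<Rightarrow> 'a \<times> complex" where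
  "unitization_mult u v =
     (fst u * fst v + snd u *\<^sub>C fst v + snd v *\<^sub>C fst u, snd u * snd v)"

definition unitization_invertible :: "'a::cstar_algebra \<times> complex \<Rightarrow> bool" where
  "unitization_invertible u \<longleftrightarrow>
     (\<exists>v. unitization_mult u v = (0, 1) \<and> unitization_mult v u = (0, 1))"

text \<open>
  The spectrum is taken in the unitization, so that non-unital algebras are covered. If the
  algebra already has a unit, this only adds the point 0 to the spectrum computed in the
  algebra itself, which does not affect positivity.
\<close>

definition spectrum :: "'a::cstar_algebra \<Rightarrow> complex set" where
  "spectrum a = {z. \<not> unitization_invertible (a, - z)}"

definition positive :: "'a::cstar_algebra \<Rightarrow> bool" where
  "positive a \<longleftrightarrow> selfadjoint a \<and> spectrum a \<subseteq> complex_of_real ` {0..}"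

definition cstar_le :: "'a::cstar_algebra \<Rightarrow> 'a \<Rightarrow> bool"  (infix "\<preceq>" 50) where
  "a \<preceq> b \<longleftrightarrow> selfadjoint a \<and> selfadjoint b \<and> positive (b - a)"

definition positive_sqrt :: "'a::cstar_algebra \<Rightarrow> 'a" where
  "positive_sqrt a = (THE b. positive b \<and> b * b = a)"

definition cstar_abs :: "'a::cstar_algebra \<Rightarrow> 'a" where
  "cstar_abs a = positive_sqrt (star a * a)"

text \<open>The class \<open>power\<close> needs a unit, hence a separate notation for squares.\<close>

abbreviation square :: "'a::cstar_algebra \<Rightarrow> 'a" where
  "square a \<equiv> a * a"

locale semi_inner_product_module =
  fixes act :: "'x::complex_vector \<Rightarrow> 'a::cstar_algebra \<Rightarrow> 'x"
    and ip :: "'x \<Rightarrow> 'x \<Rightarrow> 'a"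
  assumes act_add_left: "act (x + y) a = act x a + act y a"
    and act_add_right: "act x (a + b) = act x a + act x b"
    and act_mult: "act x (a * b) = act (act x a) b"
    and act_scaleC_left: "act (c *\<^sub>C x) a = c *\<^sub>C act x a"
    and act_scaleC_right: "act x (c *\<^sub>C a) = c *\<^sub>C act x a"
    and ip_add_right: "ip x (y + z) = ip x y + ip x z"
    and ip_act_right: "ip x (act y a) = ip x y * a"
    and star_ip: "star (ip x y) = ip y x"
    and ip_positive: "positive (ip x x)"

definition module_abs :: "('x \<Rightarrow> 'x \<Rightarrow> 'a::cstar_algebra) \<Rightarrow> 'x \<Rightarrow> 'a" where
  "module_abs ip x = positive_sqrt (ip x x)"

definition module_norm :: "('x \<Rightarrow> 'x \<Rightarrow> 'a::cstar_algebra) \<Rightarrow> 'x \<Rightarrow> real" where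
  "module_norm ip x = sqrt (norm (ip x x))"

definition probability_vector :: "nat \<Rightarrow> (nat \<Rightarrow> real) \<Rightarrow> bool" where
  "probability_vector n p \<longleftrightarrow> (\<forall>i\<in>{1..n}. 0 \<le> p i) \<and> (\<Sum>i=1..n. p i) = 1"

end

theory Submission
  imports Defs "HOL-Analysis.Operator_Norm"
begin

text \<open>
  The expression whose absolute value is estimated is the covariance of the two families,
  \<open>cov x y = (\<Sum>i. p i \<langle>x i, y i\<rangle>) - \<langle>\<Sum>i. p i x i, \<Sum>i. p i y i\<rangle>\<close>.
  It is invariant under translating either family, so that the two brackets on the right-hand side
  are \<open>cov x x\<close> and \<open>cov y y\<close>. Translating by the means removes the subtracted term, which
  exhibits \<open>cov z z\<close> as a sum of positive elements (\<open>positive_weighted_covariance\<close>). Hence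
  \<open>cov\<close> is itself a semi-inner product on families. The first inequality is its Cauchy-Schwarz
  inequality \<open>\<bar>cov x y\<bar>\<^sup>2 \<le> \<parallel>cov x x\<parallel> cov y y\<close>, obtained by expanding \<open>cov z z \<ge> 0\<close> for
  \<open>z = x c - y\<close> with \<open>c\<close> a multiple of \<open>cov x y\<close>. The second drops the positive terms
  subtracted in the two brackets and uses that the norm is monotone on positive elements.

  All this rests on elementary facts about the order of a C*-algebra: positive elements form a
  closed cone on which the norm is monotone, they have unique positive square roots, and
  \<open>a\<^sup>* a\<close> is positive. They are proved here without Gelfand theory or complex analysis.
  The working notion in a unital algebra is that of a square of a selfadjoint element. An
  explicit iteration gives a square root of \<open>1 - k\<close> when \<open>\<parallel>k\<parallel> \<le> 1\<close>, and this leads to the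
  metric criterion that a selfadjoint \<open>a\<close> is such a square if and only if \<open>\<parallel>t1 - a\<parallel> \<le> t\<close> for
  some \<open>t\<close>, and then for every \<open>t \<ge> \<parallel>a\<parallel>\<close> (\<open>hermitian_square_of_near_scalar\<close>,
  \<open>hermitian_square_near_scalar\<close>).
  The cone properties can be read off from the criterion. The link to the spectrum is
  \<open>hermitian_square_of_units\<close>: if \<open>a + s1\<close> is invertible for all \<open>s > 0\<close>, then \<open>a\<close> is a square.
  General algebras are treated by embedding them into the unitization, which is made into a
  C*-algebra by a suitable norm.
\<close>

section \<open>Complex vector spaces and the involution\<close>

lemma scaleC_zero_right: "c *\<^sub>C (0 :: 'a::complex_vector) = 0"
  using scaleC_add_right[of c "0::'a" 0] by simp

lemma scaleC_minus_right: "c *\<^sub>C (- x :: 'a::complex_vector) = - (c *\<^sub>C x)"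
  using scaleC_add_right[of c x "- x"]
  by (metis scaleC_zero_right add.right_inverse minus_unique)

lemma scaleC_minus_left: "(- c) *\<^sub>C (x :: 'a::complex_vector) = - (c *\<^sub>C x)"
proof -
  have "(- c) *\<^sub>C x + c *\<^sub>C x = 0 *\<^sub>C x" by (simp flip: scaleC_add_left)
  also have "\<dots> = 0" using scaleR_scaleC[of 0 x] by simp
  finally show ?thesis by (simp add: eq_neg_iff_add_eq_0)
qed

lemma scaleC_diff_right: "c *\<^sub>C (x - y :: 'a::complex_vector) = c *\<^sub>C x - c *\<^sub>C y"
  using scaleC_add_right[of c x "- y"] by (simp add: scaleC_minus_right)

lemma scaleC_i_i: "\<i> *\<^sub>C \<i> *\<^sub>C (x :: 'a::complex_vector) = - x"
  using scaleR_scaleC[of "-1" x] by (simp add: scaleC_scaleC)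

lemma scaleC_of_real: "complex_of_real r *\<^sub>C (x :: 'a::complex_vector) = r *\<^sub>R x"
  by (simp add: scaleR_scaleC)

lemma scaleC_zero_left: "0 *\<^sub>C (x :: 'a::complex_vector) = 0"
  using scaleC_of_real[of 0 x] by simp

lemma star_zero [simp]: "star (0 :: 'a::cstar_algebra) = 0"
  using star_add[of "0::'a" 0] by simp

lemma star_minus: "star (- x :: 'a::cstar_algebra) = - star x"
  using star_add[of x "- x"] by (simp add: minus_unique)

lemma star_diff: "star (x - y :: 'a::cstar_algebra) = star x - star y"
  using star_add[of x "- y"] by (simp add: star_minus)

lemma star_scaleR: "star (r *\<^sub>R x :: 'a::cstar_algebra) = r *\<^sub>R star x"
  by (simp add: scaleR_scaleC star_scaleC)

lemmas star_simps = star_add star_minus star_diff star_scaleR star_scaleC star_mult star_star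

lemma norm_star: "norm (star x :: 'a::cstar_algebra) = norm x"
proof -
  have le: "norm z \<le> norm (star z)" for z :: 'a
  proof (cases "z = 0")
    case False
    have "norm z * norm z \<le> norm (star z) * norm z"
      using norm_mult_ineq[of "star z" z] by (simp add: cstar_identity power2_eq_square)
    with False show ?thesis by simp
  qed simp
  from le[of x] le[of "star x"] show ?thesis by (simp add: star_star)
qed

lemma bounded_linear_star: "bounded_linear (star :: 'a::cstar_algebra \<Rightarrow> 'a)"
  by (rule bounded_linear_intro[where K = 1]) (simp_all add: star_add star_scaleR norm_star)

lemma selfadjoint_square_norm:
  assumes "selfadjoint (x :: 'a::cstar_algebra)"
  shows "norm (x * x) = (norm x)\<^sup>2"
  using cstar_identity[of x] assms by (simp add: selfadjoint_def)

lemma selfadjoint_zero [simp]: "selfadjoint (0 :: 'a::cstar_algebra)"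
  by (simp add: selfadjoint_def)

lemma selfadjoint_add: "selfadjoint x \<Longrightarrow> selfadjoint y \<Longrightarrow> selfadjoint (x + y :: 'a::cstar_algebra)"
  and selfadjoint_diff: "selfadjoint x \<Longrightarrow> selfadjoint y \<Longrightarrow> selfadjoint (x - y :: 'a::cstar_algebra)"
  and selfadjoint_minus: "selfadjoint x \<Longrightarrow> selfadjoint (- x :: 'a::cstar_algebra)"
  and selfadjoint_scaleR: "selfadjoint x \<Longrightarrow> selfadjoint (r *\<^sub>R x :: 'a::cstar_algebra)"
  and selfadjoint_mult_commute: "selfadjoint x \<Longrightarrow> selfadjoint y \<Longrightarrow> x * y = y * x \<Longrightarrow> selfadjoint (x * y :: 'a::cstar_algebra)"
  and selfadjoint_star_mult: "selfadjoint (star x * x :: 'a::cstar_algebra)"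
  by (simp_all add: selfadjoint_def star_simps)

section \<open>Square roots by iteration\<close>

text \<open>
  The solution \<open>y\<close> of \<open>2 y - y\<^sup>2 = k\<close> satisfies \<open>(1 - y)\<^sup>2 = 1 - k\<close>, but the equation makes sense
  without a unit. It is the limit of \<open>y \<mapsto> (k + y\<^sup>2) / 2\<close> started at \<open>0\<close>. The same iteration
  for the number \<open>\<parallel>k\<parallel> \<le> 1\<close> is increasing and bounded by \<open>1\<close>, and its increments dominate those
  in the algebra; this gives convergence even when \<open>\<parallel>k\<parallel> = 1\<close>. All iterates are
  polynomials in \<open>k\<close>, whence the statement on commutation.
\<close>

lemma selfadjoint_root_iteration:
  fixes k :: "'a::cstar_algebra"
  assumes k: "selfadjoint k" "norm k \<le> 1"
  obtains y where "selfadjoint y" "norm y \<le> 1" "2 *\<^sub>R y - y * y = k"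
    "\<And>z. z * k = k * z \<Longrightarrow> z * y = y * z"
proof -
  define f :: "nat \<Rightarrow> 'a" where "f = rec_nat 0 (\<lambda>_ u. (1/2) *\<^sub>R (k + u * u))"
  define e :: "nat \<Rightarrow> real" where "e = rec_nat 0 (\<lambda>_ u. (1/2) * (norm k + u * u))"
  have f0: "f 0 = 0" and fS: "f (Suc n) = (1/2) *\<^sub>R (k + f n * f n)" for n
    by (simp_all add: f_def)
  have e0: "e 0 = 0" and eS: "e (Suc n) = (1/2) * (norm k + e n * e n)" for n
    by (simp_all add: e_def)
  have comm: "z * f n = f n * z" if "z * k = k * z" for z n
  proof (induction n)
    case (Suc n)
    have "z * (f n * f n) = (f n * f n) * z"
      by (metis Suc.IH mult.assoc)
    then show ?case using that by (simp add: fS distrib_left distrib_right)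
  qed (simp add: f0)
  have ff: "f m * f n = f n * f m" for m n
    using comm[of "f m" n] comm[of k m] by simp
  have sa: "selfadjoint (f n)" for n
    by (induction n) (simp_all add: f0 fS selfadjoint_scaleR selfadjoint_add selfadjoint_mult_commute k)
  have e_nonneg: "0 \<le> e n" for n by (cases n) (simp_all add: e0 eS)
  have e_le: "e n \<le> 1" for n
  proof (induction n)
    case (Suc n)
    have "e n * e n \<le> 1 * 1" by (rule mult_mono) (use Suc e_nonneg in auto)
    then show ?case using k by (simp add: eS)
  qed (simp add: e0)
  have fe: "norm (f n) \<le> e n" for n
  proof (induction n)
    case (Suc n)
    have "norm (f n * f n) \<le> e n * e n"
      using norm_mult_ineq[of "f n" "f n"] mult_mono[OF Suc Suc] e_nonneg[of n] by simp
    then show ?case using norm_triangle_ineq[of k "f n * f n"] by (simp add: fS eS)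
  qed (simp add: f0 e0)
  have step: "norm (f (Suc n) - f n) \<le> e (Suc n) - e n" for n
  proof (induction n)
    case 0 show ?case by (simp add: f0 e0 fS eS)
  next
    case (Suc n)
    have "f (Suc (Suc n)) - f (Suc n) = (1/2) *\<^sub>R (f (Suc n) * f (Suc n) - f n * f n)"
      by (subst fS, subst (3) fS) (simp add: algebra_simps)
    also have "f (Suc n) * f (Suc n) - f n * f n = (f (Suc n) + f n) * (f (Suc n) - f n)"
      using ff[of n "Suc n"] by (simp add: algebra_simps)
    finally have "norm (f (Suc (Suc n)) - f (Suc n))
        \<le> (1/2) * (norm (f (Suc n) + f n) * norm (f (Suc n) - f n))"
      using norm_mult_ineq[of "f (Suc n) + f n" "f (Suc n) - f n"] by simp
    also have "\<dots> \<le> (1/2) * ((e (Suc n) + e n) * (e (Suc n) - e n))"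
    proof -
      have "norm (f (Suc n) + f n) \<le> e (Suc n) + e n"
        using norm_triangle_ineq[of "f (Suc n)" "f n"] fe[of n] fe[of "Suc n"] by linarith
      then show ?thesis using Suc e_nonneg[of n] e_nonneg[of "Suc n"]
        by (intro mult_left_mono mult_mono) auto
    qed
    also have "\<dots> = e (Suc (Suc n)) - e (Suc n)"
    proof -
      have "e (Suc (Suc n)) - e (Suc n) = (1/2) * (e (Suc n) * e (Suc n) - e n * e n)"
      proof -
        have lin: "q - r = (1/2) * (u - v)"
          if "r = (1/2) * (t + v)" "q = (1/2) * (t + u)" for q r t u v :: real
          using that by simp
        show ?thesis by (rule lin[OF eS eS])
      qed
      then show ?thesis by (simp add: algebra_simps)
    qed
    finally show ?case .
  qed
  have "incseq e" using step by (intro incseq_SucI) (smt (verit) norm_ge_zero)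
  then obtain l where "e \<longlonglongrightarrow> l" using incseq_convergent[of e 1] e_le by blast
  then have "summable (\<lambda>n. e (Suc n) - e n)" by (rule telescope_summable)
  then have "summable (\<lambda>n. f (Suc n) - f n)"
    by (rule summable_comparison_test[rotated]) (use step in auto)
  then have "(\<lambda>n. \<Sum>i<n. f (Suc i) - f i) \<longlonglongrightarrow> (\<Sum>i. f (Suc i) - f i)"
    by (rule summable_LIMSEQ)
  then obtain y where y: "f \<longlonglongrightarrow> y" by (auto simp: sum_lessThan_telescope f0)
  show thesis
  proof
    have "(\<lambda>n. star (f n)) \<longlonglongrightarrow> star y" by (rule bounded_linear.tendsto[OF bounded_linear_star y])
    moreover have "star (f n) = f n" for n using sa by (simp add: selfadjoint_def)
    ultimately show "selfadjoint y" using y LIMSEQ_unique by (auto simp: selfadjoint_def)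
    show "norm y \<le> 1"
      by (rule LIMSEQ_le_const2[OF tendsto_norm[OF y]]) (use fe e_le order_trans in blast)
    have "(\<lambda>n. (1/2) *\<^sub>R (k + f n * f n)) \<longlonglongrightarrow> (1/2) *\<^sub>R (k + y * y)"
      by (intro tendsto_intros y)
    then have "(\<lambda>n. f (Suc n)) \<longlonglongrightarrow> (1/2) *\<^sub>R (k + y * y)" by (simp add: fS)
    then have "y = (1/2) *\<^sub>R (k + y * y)" using LIMSEQ_Suc[OF y] LIMSEQ_unique by blast
    then have "2 *\<^sub>R y = 2 *\<^sub>R ((1/2) *\<^sub>R (k + y * y))" by simp
    then have "2 *\<^sub>R y = k + y * y" by simp
    then show "2 *\<^sub>R y - y * y = k" by simp
    show "z * y = y * z" if "z * k = k * z" for z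
    proof -
      have "(\<lambda>n. z * f n) \<longlonglongrightarrow> z * y" "(\<lambda>n. f n * z) \<longlonglongrightarrow> y * z"
        by (intro tendsto_intros y)+
      then show ?thesis using comm[OF that] LIMSEQ_unique by auto
    qed
  qed
qed

section \<open>Squares of selfadjoint elements in unital algebras\<close>

class unital_cstar_algebra = cstar_algebra + real_normed_algebra_1

lemma star_one [simp]: "star (1 :: 'a::unital_cstar_algebra) = 1"
  by (metis star_mult star_star mult_1_right)

lemma selfadjoint_one [simp]: "selfadjoint (1 :: 'a::unital_cstar_algebra)"
  by (simp add: selfadjoint_def)

text \<open>
  The element \<open>u = x + \<i> y\<close> satisfies \<open>u\<^sup>* u = s1\<close>, so \<open>\<parallel>u\<parallel>\<^sup>2 = s\<close>, and \<open>x\<close> is the real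
  part of \<open>u\<close>. This replaces the functional calculus in the comparison of norms.
\<close>

lemma norm_square_le_of_commuting_squares:
  fixes x y :: "'a::unital_cstar_algebra"
  assumes sa: "selfadjoint x" "selfadjoint y" and comm: "x * y = y * x"
    and sum: "x * x + y * y = s *\<^sub>R 1" and s: "0 \<le> s"
  shows "norm (x * x) \<le> s"
proof -
  define u where "u = x + \<i> *\<^sub>C y"
  have st: "star u = x - \<i> *\<^sub>C y"
    using sa by (simp add: u_def selfadjoint_def star_simps scaleC_minus_left)
  have "star u * u = x * x + y * y"
    unfolding st unfolding u_def
    by (simp add: distrib_left left_diff_distrib scaleC_mult_left scaleC_mult_right
        scaleC_i_i comm scaleC_diff_right)
  then have "(norm u)\<^sup>2 = s" using cstar_identity[of u] sum s by simp
  moreover have "norm x \<le> norm u"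
  proof -
    have "2 *\<^sub>R x = u + star u" unfolding st unfolding u_def by (simp add: scaleR_2)
    then have "2 * norm x \<le> norm u + norm (star u)"
      using norm_triangle_ineq[of u "star u"] by (metis norm_scaleR abs_numeral)
    then show ?thesis by (simp add: norm_star)
  qed
  ultimately show ?thesis
    using power_mono[of "norm x" "norm u" 2] selfadjoint_square_norm[OF sa(1)] by simp
qed

text \<open>
  In a unital algebra this is positivity, in a form that can be handled without the spectrum.
\<close>

definition hermitian_square :: "'a::cstar_algebra \<Rightarrow> bool" where
  "hermitian_square a \<longleftrightarrow> (\<exists>x. selfadjoint x \<and> a = x * x)"

lemma hermitian_squareI: "selfadjoint x \<Longrightarrow> hermitian_square (x * x)"
  by (auto simp: hermitian_square_def)

lemma hermitian_square_selfadjoint: "hermitian_square a \<Longrightarrow> selfadjoint a"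
  by (auto simp: hermitian_square_def selfadjoint_mult_commute)

text \<open>
  Writing \<open>a = t (1 - k)\<close> turns the hypothesis into \<open>\<parallel>k\<parallel> \<le> 1\<close>, so that
  \<open>r = \<surd>t (1 - y)\<close> with the \<open>y\<close> of the iteration is a root. It is again close to a
  multiple of \<open>1\<close>, which makes it a square in its turn.
\<close>

lemma root_of_near_scalar:
  fixes a :: "'a::unital_cstar_algebra"
  assumes a: "selfadjoint a" and le: "norm (t *\<^sub>R 1 - a) \<le> t"
  obtains r where "selfadjoint r" "norm (sqrt t *\<^sub>R 1 - r) \<le> sqrt t" "r * r = a"
    "\<And>z. z * a = a * z \<Longrightarrow> z * r = r * z"
proof (cases "t = 0")
  case True
  with le that[of 0] show ?thesis by simp
next
  case False
  with le have t: "t > 0" using norm_ge_zero order_less_le order_trans by metis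
  define k where "k = 1 - (1/t) *\<^sub>R a"
  have ka: "a = t *\<^sub>R (1 - k)" using t by (simp add: k_def)
  have "k = (1/t) *\<^sub>R (t *\<^sub>R 1 - a)" using t by (simp add: k_def algebra_simps)
  then have "norm k = (1/t) * norm (t *\<^sub>R 1 - a)" using t by simp
  also have "\<dots> \<le> 1" using le t by (simp add: field_simps)
  finally have "norm k \<le> 1" .
  moreover have "selfadjoint k" using a by (simp add: k_def selfadjoint_diff selfadjoint_scaleR)
  ultimately obtain y where y: "selfadjoint y" "norm y \<le> 1" "2 *\<^sub>R y - y * y = k"
    "\<And>z. z * k = k * z \<Longrightarrow> z * y = y * z" using selfadjoint_root_iteration by blast
  define r where "r = sqrt t *\<^sub>R (1 - y)"
  show thesis
  proof
    show "selfadjoint r" using y(1) by (simp add: r_def selfadjoint_diff selfadjoint_scaleR)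
    have "sqrt t *\<^sub>R 1 - r = sqrt t *\<^sub>R y" by (simp add: r_def algebra_simps)
    then show "norm (sqrt t *\<^sub>R 1 - r) \<le> sqrt t" using y(2) t by (simp add: mult_left_le)
    have "r * r = t *\<^sub>R ((1 - y) * (1 - y))" using t by (simp add: r_def)
    also have "(1 - y) * (1 - y) = 1 - k" using y(3) by (simp add: algebra_simps scaleR_2)
    finally show "r * r = a" using ka by simp
    fix z assume "z * a = a * z"
    then have "z * k = k * z" by (simp add: k_def algebra_simps)
    then show "z * r = r * z" using y(4) by (simp add: r_def algebra_simps)
  qed
qed

lemma hermitian_square_of_near_scalar:
  "selfadjoint a \<Longrightarrow> norm (t *\<^sub>R 1 - a) \<le> t \<Longrightarrow> hermitian_square (a :: 'a::unital_cstar_algebra)"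
  by (metis root_of_near_scalar hermitian_squareI)

text \<open>
  Since \<open>t1 - a\<close> differs from \<open>t1\<close> by at most \<open>t\<close>, it has a root \<open>y\<close> commuting with a root
  \<open>x\<close> of \<open>a\<close>. As \<open>x\<^sup>2 + y\<^sup>2 = t1\<close>, the norm of \<open>y\<^sup>2 = t1 - a\<close> is at most \<open>t\<close>.
\<close>

lemma hermitian_square_near_scalar:
  fixes a :: "'a::unital_cstar_algebra"
  assumes a: "hermitian_square a" and t: "norm a \<le> t"
  shows "norm (t *\<^sub>R 1 - a) \<le> t"
proof -
  obtain x where x: "selfadjoint x" "a = x * x" using a by (auto simp: hermitian_square_def)
  have "selfadjoint (t *\<^sub>R 1 - a)"
    using a by (simp add: hermitian_square_selfadjoint selfadjoint_diff selfadjoint_scaleR)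
  moreover have "norm (t *\<^sub>R 1 - (t *\<^sub>R 1 - a)) \<le> t" using t by simp
  ultimately obtain y where y: "selfadjoint y" "y * y = t *\<^sub>R 1 - a"
    "\<And>z. z * (t *\<^sub>R 1 - a) = (t *\<^sub>R 1 - a) * z \<Longrightarrow> z * y = y * z"
    using root_of_near_scalar by metis
  have "x * y = y * x" by (rule y(3)) (simp add: x algebra_simps)
  then have "norm (y * y) \<le> t"
    using x y(1,2) order_trans[OF norm_ge_zero t] by (intro norm_square_le_of_commuting_squares[of y x]) auto
  then show ?thesis by (simp add: y(2))
qed

lemma hermitian_square_root:
  fixes a :: "'a::unital_cstar_algebra"
  assumes "hermitian_square a"
  obtains r where "hermitian_square r" "r * r = a" "\<And>z. z * a = a * z \<Longrightarrow> z * r = r * z"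
  using root_of_near_scalar[OF hermitian_square_selfadjoint[OF assms] hermitian_square_near_scalar[OF assms order_refl]]
    hermitian_square_of_near_scalar by metis

lemma hermitian_square_add:
  fixes a b :: "'a::unital_cstar_algebra"
  assumes "hermitian_square a" "hermitian_square b"
  shows "hermitian_square (a + b)"
proof (rule hermitian_square_of_near_scalar)
  show "selfadjoint (a + b)" using assms by (simp add: hermitian_square_selfadjoint selfadjoint_add)
  have "(norm a + norm b) *\<^sub>R 1 - (a + b) = (norm a *\<^sub>R 1 - a) + (norm b *\<^sub>R 1 - b)"
    by (simp add: algebra_simps)
  also have "norm \<dots> \<le> norm a + norm b"
    using assms[THEN hermitian_square_near_scalar, OF order_refl]
    by (intro norm_triangle_le add_mono)
  finally show "norm ((norm a + norm b) *\<^sub>R 1 - (a + b)) \<le> norm a + norm b" .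
qed

lemma hermitian_square_scaleR:
  assumes "hermitian_square (a :: 'a::cstar_algebra)" "0 \<le> t"
  shows "hermitian_square (t *\<^sub>R a)"
proof -
  obtain x where "selfadjoint x" "a = x * x" using assms by (auto simp: hermitian_square_def)
  then show ?thesis
    using assms hermitian_squareI[of "sqrt t *\<^sub>R x"] by (simp add: selfadjoint_scaleR)
qed

lemma hermitian_square_scalar: "0 \<le> t \<Longrightarrow> hermitian_square (t *\<^sub>R 1 :: 'a::unital_cstar_algebra)"
  using hermitian_square_scaleR hermitian_squareI[of "1::'a"] by simp

lemma hermitian_square_norm_bound_diff:
  fixes a :: "'a::unital_cstar_algebra"
  assumes "selfadjoint a" "norm a \<le> t"
  shows "hermitian_square (t *\<^sub>R 1 - a)"
  by (rule hermitian_square_of_near_scalar[where t = t])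
     (use assms in \<open>simp_all add: selfadjoint_diff selfadjoint_scaleR\<close>)

text \<open>
  The form in which closedness of the cone is used: the inequality \<open>\<parallel>t1 - a\<parallel> \<le> t\<close> survives
  the passage to the limit.
\<close>

lemma hermitian_square_archimedean:
  fixes b :: "'a::unital_cstar_algebra"
  assumes b: "selfadjoint b" and eps: "\<And>\<epsilon>. \<epsilon> > 0 \<Longrightarrow> hermitian_square (b + \<epsilon> *\<^sub>R 1)"
  shows "hermitian_square b"
proof (rule hermitian_square_of_near_scalar[OF b])
  show "norm (norm b *\<^sub>R 1 - b) \<le> norm b"
  proof (rule field_le_epsilon)
    fix \<epsilon> :: real assume e: "\<epsilon> > 0"
    have "norm (b + \<epsilon> *\<^sub>R 1) \<le> norm b + \<epsilon>"
      using norm_triangle_ineq[of b "\<epsilon> *\<^sub>R 1"] e by simp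
    from hermitian_square_near_scalar[OF eps[OF e] this]
    show "norm (norm b *\<^sub>R 1 - b) \<le> norm b + \<epsilon>" by (simp add: algebra_simps)
  qed
qed

lemma norm_le_of_hermitian_square_diff:
  fixes a :: "'a::unital_cstar_algebra"
  assumes a: "hermitian_square a" and d: "hermitian_square (s *\<^sub>R 1 - a)" and s: "0 \<le> s"
  shows "norm a \<le> s"
proof -
  obtain x where x: "hermitian_square x" "x * x = a" "\<And>z. z * a = a * z \<Longrightarrow> z * x = x * z"
    using hermitian_square_root[OF a] by metis
  obtain y where y: "hermitian_square y" "y * y = s *\<^sub>R 1 - a"
      "\<And>z. z * (s *\<^sub>R 1 - a) = (s *\<^sub>R 1 - a) * z \<Longrightarrow> z * y = y * z"
    using hermitian_square_root[OF d] by metis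
  have "x * y = y * x" by (rule y(3)) (simp add: x(2)[symmetric] algebra_simps)
  then show ?thesis
    using norm_square_le_of_commuting_squares[of x y s] x(1,2) y(1,2) s by (simp add: hermitian_square_selfadjoint)
qed

lemma norm_mono_hermitian_square:
  fixes a b :: "'a::unital_cstar_algebra"
  assumes a: "hermitian_square a" and d: "hermitian_square (b - a)"
  shows "norm a \<le> norm b"
proof (rule norm_le_of_hermitian_square_diff[OF a])
  have "selfadjoint ((b - a) + a)" using a d by (intro selfadjoint_add hermitian_square_selfadjoint)
  then have "hermitian_square (norm b *\<^sub>R 1 - b)"
    by (simp add: hermitian_square_norm_bound_diff)
  from hermitian_square_add[OF this d] show "hermitian_square (norm b *\<^sub>R 1 - a)" by simp
qed simp

lemma hermitian_square_antisym:
  fixes a :: "'a::unital_cstar_algebra"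
  assumes "hermitian_square a" "hermitian_square (- a)"
  shows "a = 0"
  using norm_mono_hermitian_square[of a 0] assms by simp

text \<open>
  The commuting case of \<open>d r d \<ge> 0\<close>; it precedes, and is used for, the positivity of \<open>a\<^sup>* a\<close>.
\<close>

lemma hermitian_square_sandwich_commute:
  fixes r d :: "'a::unital_cstar_algebra"
  assumes r: "hermitian_square r" and d: "selfadjoint d" and comm: "d * r = r * d"
  shows "hermitian_square (d * r * d)"
proof -
  obtain q where q: "hermitian_square q" "q * q = r" "\<And>z. z * r = r * z \<Longrightarrow> z * q = q * z"
    using hermitian_square_root[OF r] by metis
  have dq: "d * q = q * d" using q(3)[OF comm] .
  have "d * r * d = (d * q) * (q * d)" by (simp add: q(2)[symmetric] mult.assoc)
  also have "\<dots> = (d * q) * (d * q)" by (simp only: dq)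
  finally show ?thesis
    using hermitian_squareI[of "d * q"] selfadjoint_mult_commute[OF d hermitian_square_selfadjoint[OF q(1)] dq]
    by simp
qed

lemma selfadjoint_cube_zero:
  fixes d :: "'a::cstar_algebra"
  assumes d: "selfadjoint d" and "d * d * d = 0"
  shows "d = 0"
proof -
  have "(d * d) * (d * d) = 0" using assms by (simp add: mult.assoc[symmetric])
  then have "norm (d * d) = 0"
    using selfadjoint_square_norm[of "d * d"] d by (simp add: selfadjoint_mult_commute)
  then show ?thesis using selfadjoint_square_norm[OF d] by simp
qed

text \<open>
  Every root \<open>w\<close> is compared with the root \<open>r\<close> that commutes with everything commuting with its
  square. For \<open>d = r - w\<close> one has \<open>d (r + w) = r\<^sup>2 - w\<^sup>2 = 0\<close>, so the positive elements
  \<open>d r d\<close> and \<open>d w d\<close> add up to \<open>0\<close>. Both vanish, hence so does their difference \<open>d\<^sup>3\<close>.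
\<close>

lemma hermitian_square_root_unique:
  fixes b c :: "'a::unital_cstar_algebra"
  assumes b: "hermitian_square b" and c: "hermitian_square c" and eq: "b * b = c * c"
  shows "b = c"
proof -
  obtain r where r: "hermitian_square r" "r * r = c * c" "\<And>z. z * (c * c) = (c * c) * z \<Longrightarrow> z * r = r * z"
    using hermitian_square_root[of "c * c"] hermitian_squareI[OF hermitian_square_selfadjoint[OF c]] by metis
  have "w = r" if w: "hermitian_square w" "w * w = c * c" for w
  proof -
    have comm: "w * r = r * w" by (rule r(3)) (simp add: w(2)[symmetric] mult.assoc)
    define d where "d = r - w"
    have d: "selfadjoint d" using r(1) w(1) by (simp add: d_def selfadjoint_diff hermitian_square_selfadjoint)
    have dr: "d * r = r * d" and dw: "d * w = w * d" by (simp_all add: d_def comm algebra_simps)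
    have z: "d * (r + w) = 0" using r(2) w(2) comm by (simp add: d_def algebra_simps)
    have sum: "d * r * d + d * w * d = 0"
      using arg_cong[OF z, of "\<lambda>u. u * d"] by (simp add: algebra_simps)
    have hr: "hermitian_square (d * r * d)" and hw: "hermitian_square (d * w * d)"
      using hermitian_square_sandwich_commute d dr dw r(1) w(1) by blast+
    have "d * r * d = 0" using hermitian_square_antisym[OF hr] hw sum by (metis add.inverse_unique)
    moreover from this have "d * w * d = 0" using sum by simp
    ultimately have "d * d * d = 0" by (subst (2) d_def) (simp add: algebra_simps)
    then show ?thesis using selfadjoint_cube_zero[OF d] by (simp add: d_def)
  qed
  from this[OF b eq] this[OF c refl] show ?thesis by simp
qed

section \<open>Squares and invertibility\<close>

text \<open>The divisibility predicate \<open>is_unit\<close> presupposes commutativity.\<close>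

definition two_sided_unit :: "'a::monoid_mult \<Rightarrow> bool" where
  "two_sided_unit u \<longleftrightarrow> (\<exists>v. u * v = 1 \<and> v * u = 1)"

lemma two_sided_unit_neumann:
  fixes k :: "'a::unital_cstar_algebra"
  assumes "norm k < 1"
  shows "two_sided_unit (1 - k)"
proof -
  have sm: "summable (\<lambda>n. k ^ n)" by (rule complete_algebra_summable_geometric[OF assms])
  define v where "v = (\<Sum>n. k ^ n)"
  have "v = 1 + (\<Sum>n. k ^ Suc n)" using suminf_split_head[OF sm] by (simp add: v_def)
  moreover have "(\<Sum>n. k ^ Suc n) = k * v" "(\<Sum>n. k ^ Suc n) = v * k"
    using suminf_mult[OF sm, of k] suminf_mult2[OF sm, of k] by (simp_all add: v_def power_commutes)
  ultimately have "v = 1 + k * v" "v = 1 + v * k" by simp_all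
  then have "(1 - k) * v = 1" "v * (1 - k) = 1" by (simp_all add: algebra_simps)
  then show ?thesis by (auto simp: two_sided_unit_def)
qed

lemma two_sided_unit_hermitian_square_add:
  fixes a :: "'a::unital_cstar_algebra"
  assumes a: "hermitian_square a" and s: "s > 0"
  shows "two_sided_unit (a + s *\<^sub>R 1)"
proof -
  define t where "t = norm a + s"
  have t: "t > 0" using s norm_ge_zero[of a] by (simp add: t_def add_nonneg_pos)
  define k where "k = (1/t) *\<^sub>R (norm a *\<^sub>R 1 - a)"
  \<comment> \<open>\<open>a + s1 = t (1 - k)\<close>, and \<open>\<parallel>k\<parallel> \<le> \<parallel>a\<parallel> / t < 1\<close> because \<open>t\<close> exceeds \<open>\<parallel>a\<parallel>\<close> by \<open>s\<close>\<close>
  have "norm k = (1/t) * norm (norm a *\<^sub>R 1 - a)" using t by (simp add: k_def)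
  also have "\<dots> \<le> (1/t) * norm a"
    using hermitian_square_near_scalar[OF a order_refl] t by (intro mult_left_mono) auto
  also have "\<dots> < 1" using t s by (simp add: t_def)
  finally obtain v where v: "(1 - k) * v = 1" "v * (1 - k) = 1"
    using two_sided_unit_neumann unfolding two_sided_unit_def by blast
  have e: "a + s *\<^sub>R 1 = t *\<^sub>R (1 - k)"
    using t by (simp add: k_def scaleR_right_diff_distrib) (simp add: t_def algebra_simps)
  have "(a + s *\<^sub>R 1) * ((1/t) *\<^sub>R v) = 1" "((1/t) *\<^sub>R v) * (a + s *\<^sub>R 1) = 1"
    unfolding e using v t by simp_all
  then show ?thesis unfolding two_sided_unit_def by blast
qed

lemma two_sided_unit_commuting_factor:
  fixes u w :: "'a::monoid_mult"
  assumes comm: "u * w = w * u" and unit: "two_sided_unit (u * w)"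
  shows "two_sided_unit u"
proof -
  obtain v where v: "(u * w) * v = 1" "v * (u * w) = 1" using unit by (auto simp: two_sided_unit_def)
  have l: "(v * w) * u = 1" using v(2) comm by (simp add: mult.assoc)
  have r: "u * (w * v) = 1" using v(1) by (simp add: mult.assoc)
  have "v * w = w * v" using l r by (metis mult.assoc mult_1_left mult_1_right)
  then show ?thesis using l r unfolding two_sided_unit_def by metis
qed

text \<open>
  Invertible elements are interior to the cone. With \<open>a = d\<^sup>2\<close> and \<open>v = 1 / a\<close> the element
  \<open>a - \<epsilon>1 = d (1 - \<epsilon> v) d\<close> is a square as soon as \<open>\<parallel>\<epsilon> v\<parallel> \<le> 1\<close>.
\<close>

lemma hermitian_square_diff_scalar_of_unit:
  fixes a :: "'a::unital_cstar_algebra"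
  assumes a: "hermitian_square a" and u: "two_sided_unit a"
  obtains \<epsilon> where "\<epsilon> > 0" "hermitian_square (a - \<epsilon> *\<^sub>R 1)"
proof -
  obtain v where v: "a * v = 1" "v * a = 1" using u by (auto simp: two_sided_unit_def)
  obtain d where d: "selfadjoint d" "a = d * d" using a by (auto simp: hermitian_square_def)
  have sa: "selfadjoint a" using a by (rule hermitian_square_selfadjoint)
  have "star v * a = 1" using arg_cong[OF v(1), of star] sa by (simp add: star_mult selfadjoint_def)
  then have sv: "selfadjoint v"
    unfolding selfadjoint_def by (metis v(1) mult.assoc mult_1_left mult_1_right)
  have dv: "d * v = v * d"
  proof -
    have "a * d = d * a" by (simp add: d mult.assoc)
    then have "v * (a * d) * v = v * (d * a) * v" by simp
    then show ?thesis using v by (metis mult.assoc mult_1_left mult_1_right)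
  qed
  define \<epsilon> where "\<epsilon> = 1 / (norm v + 1)"
  have pos: "norm v + 1 > 0" using norm_ge_zero[of v] by linarith
  then have e: "\<epsilon> > 0" by (simp add: \<epsilon>_def)
  have "norm (\<epsilon> *\<^sub>R v) \<le> 1" using pos by (simp add: \<epsilon>_def field_simps)
  then have "hermitian_square (1 *\<^sub>R 1 - \<epsilon> *\<^sub>R v)"
    by (intro hermitian_square_norm_bound_diff selfadjoint_scaleR sv)
  then have "hermitian_square (d * (1 - \<epsilon> *\<^sub>R v) * d)"
    using d dv by (intro hermitian_square_sandwich_commute) (auto simp: algebra_simps)
  moreover have "d * (1 - \<epsilon> *\<^sub>R v) * d = a - \<epsilon> *\<^sub>R 1"
    using v(2) dv by (simp add: d algebra_simps)
  ultimately show thesis using that e by simp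
qed

text \<open>
  Let \<open>S\<close> be the least \<open>s \<ge> 0\<close> for which \<open>a + s1\<close> lies in the cone; the infimum is attained
  because the cone is closed. If \<open>S > 0\<close>, then \<open>a + S1\<close> is invertible and therefore interior
  to the cone, contradicting minimality. This replaces the spectral radius formula.
\<close>

lemma hermitian_square_of_units:
  fixes a :: "'a::unital_cstar_algebra"
  assumes a: "selfadjoint a" and units: "\<And>s. s > 0 \<Longrightarrow> two_sided_unit (a + s *\<^sub>R 1)"
  shows "hermitian_square a"
proof -
  define T where "T = {s. 0 \<le> s \<and> hermitian_square (a + s *\<^sub>R 1)}"
  have "norm a \<in> T"
    using hermitian_square_norm_bound_diff[of "- a" "norm a"] a
    by (simp add: T_def selfadjoint_minus add.commute)
  then have ne: "T \<noteq> {}" by blast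
  have bdd: "bdd_below T" by (auto simp: T_def bdd_below_def)
  define S where "S = Inf T"
  have S0: "0 \<le> S" unfolding S_def by (rule cInf_greatest[OF ne]) (simp add: T_def)
  have "hermitian_square (a + S *\<^sub>R 1)"
  proof (rule hermitian_square_archimedean)
    show "selfadjoint (a + S *\<^sub>R 1)" using a by (simp add: selfadjoint_add selfadjoint_scaleR)
    fix \<epsilon> :: real assume "\<epsilon> > 0"
    then obtain s where s: "s \<in> T" "s < S + \<epsilon>"
      using cInf_lessD[OF ne, of "S + \<epsilon>"] by (auto simp: S_def)
    have "hermitian_square ((a + s *\<^sub>R 1) + (S + \<epsilon> - s) *\<^sub>R 1)"
      using s by (auto simp: T_def intro: hermitian_square_add[OF _ hermitian_square_scalar])
    then show "hermitian_square (a + S *\<^sub>R 1 + \<epsilon> *\<^sub>R 1)" by (simp add: algebra_simps)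
  qed
  moreover have "S = 0"
  proof (rule ccontr)
    assume "S \<noteq> 0"
    then have "S > 0" using S0 by simp
    then obtain \<epsilon> where e: "\<epsilon> > 0" "hermitian_square (a + S *\<^sub>R 1 - \<epsilon> *\<^sub>R 1)"
      using hermitian_square_diff_scalar_of_unit[OF calculation units] by metis
    define \<delta> where "\<delta> = min \<epsilon> S"
    have "hermitian_square ((a + S *\<^sub>R 1 - \<epsilon> *\<^sub>R 1) + (\<epsilon> - \<delta>) *\<^sub>R 1)"
      using e by (intro hermitian_square_add hermitian_square_scalar) (auto simp: \<delta>_def)
    then have "S - \<delta> \<in> T" by (simp add: T_def \<delta>_def algebra_simps)
    then have "S \<le> S - \<delta>" unfolding S_def by (rule cInf_lower[OF _ bdd])
    then show False using e \<open>S > 0\<close> by (simp add: \<delta>_def split: if_splits)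
  qed
  ultimately show ?thesis by simp
qed

text \<open>
  A negative real \<open>z\<close> is covered by the Neumann series. For non-real \<open>z\<close> put \<open>c = a - Re z\<close>; then
  \<open>a - z\<close> divides \<open>c\<^sup>2 + (Im z)\<^sup>2\<close>, which is a square plus a positive scalar.
\<close>

lemma hermitian_square_resolvent:
  fixes a :: "'a::unital_cstar_algebra"
  assumes a: "hermitian_square a" and z: "z \<notin> complex_of_real ` {0..}"
  shows "two_sided_unit (a - z *\<^sub>C 1)"
proof (cases "Im z = 0")
  case True
  then have ze: "z = complex_of_real (Re z)" by (simp add: complex_eq_iff)
  then have "Re z < 0" using z by (metis atLeast_iff image_eqI not_le)
  then have "two_sided_unit (a + (- Re z) *\<^sub>R 1)"
    by (intro two_sided_unit_hermitian_square_add a) simp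
  moreover have "z *\<^sub>C (1::'a) = Re z *\<^sub>R 1" by (subst ze) (simp add: scaleC_of_real)
  ultimately show ?thesis by simp
next
  case False
  define c where "c = a - Re z *\<^sub>R 1"
  define j where "j = \<i> *\<^sub>C (1::'a)"
  have jj: "j * j = - 1" by (simp add: j_def scaleC_mult_left scaleC_i_i)
  have jc: "j * c = c * j" by (simp add: j_def scaleC_mult_left scaleC_mult_right)
  have zj: "z *\<^sub>C (1::'a) = Re z *\<^sub>R 1 + Im z *\<^sub>R j"
    unfolding j_def scaleR_scaleC scaleC_scaleC scaleC_add_left[symmetric]
    by (rule arg_cong[where f = "\<lambda>w. w *\<^sub>C 1"]) (simp add: complex_eq_iff)
  have fac: "(a - z *\<^sub>C 1) * (c + Im z *\<^sub>R j) = c * c + (Im z)\<^sup>2 *\<^sub>R 1"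
    unfolding zj using jj jc by (simp add: c_def algebra_simps power2_eq_square)
  have "two_sided_unit (c * c + (Im z)\<^sup>2 *\<^sub>R 1)"
    using False a by (intro two_sided_unit_hermitian_square_add hermitian_squareI)
      (auto simp: c_def selfadjoint_diff selfadjoint_scaleR hermitian_square_selfadjoint)
  moreover have "(a - z *\<^sub>C 1) * (c + Im z *\<^sub>R j) = (c + Im z *\<^sub>R j) * (a - z *\<^sub>C 1)"
    unfolding zj using jj jc by (simp add: c_def algebra_simps)
  ultimately show ?thesis using two_sided_unit_commuting_factor fac by metis
qed

section \<open>Positivity of the products \<open>a\<^sup>* a\<close>\<close>

text \<open>
  Invertibility of \<open>c c\<^sup>* + s1\<close> carries over to \<open>c\<^sup>* c + s1\<close>, with the explicit inverse
  \<open>(1 - c\<^sup>* v c) / s\<close> for \<open>v\<close> the inverse of the former.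
\<close>

lemma hermitian_square_star_mult_swap:
  fixes c :: "'a::unital_cstar_algebra"
  assumes "hermitian_square (c * star c)"
  shows "hermitian_square (star c * c)"
proof (rule hermitian_square_of_units[OF selfadjoint_star_mult])
  fix s :: real assume s: "s > 0"
  obtain v where v: "(c * star c + s *\<^sub>R 1) * v = 1" "v * (c * star c + s *\<^sub>R 1) = 1"
    using two_sided_unit_hermitian_square_add[OF assms s] by (auto simp: two_sided_unit_def)
  define m where "m = star c * v * c"
  have "c * star c * v = 1 - s *\<^sub>R v" "v * c * star c = 1 - s *\<^sub>R v"
    using v by (simp_all add: algebra_simps)
  then have e: "star c * (c * star c * v) * c = star c * (1 - s *\<^sub>R v) * c"
      "star c * (v * c * star c) * c = star c * (1 - s *\<^sub>R v) * c" by simp_all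
  have "star c * c * m = star c * c - s *\<^sub>R m" "m * (star c * c) = star c * c - s *\<^sub>R m"
    using e by (simp_all add: m_def algebra_simps)
  then have "(star c * c + s *\<^sub>R 1) * (1 - m) = s *\<^sub>R 1" "(1 - m) * (star c * c + s *\<^sub>R 1) = s *\<^sub>R 1"
    by (simp_all add: distrib_left distrib_right left_diff_distrib right_diff_distrib scaleR_right_diff_distrib)
  then have "(star c * c + s *\<^sub>R 1) * ((1/s) *\<^sub>R (1 - m)) = 1"
      "((1/s) *\<^sub>R (1 - m)) * (star c * c + s *\<^sub>R 1) = 1"
    using s by simp_all
  then show "two_sided_unit (star c * c + s *\<^sub>R 1)" unfolding two_sided_unit_def by blast
qed

text \<open>
  With \<open>c\<close> decomposed into its real and imaginary parts, \<open>c c\<^sup>* + c\<^sup>* c\<close> is a sum of squares.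
  If \<open>- c\<^sup>* c \<ge> 0\<close>, then \<open>c c\<^sup>*\<close>, being that sum minus \<open>c\<^sup>* c\<close>, is positive; so
  \<open>c\<^sup>* c\<close> is positive too, and antisymmetry applies.
\<close>

lemma star_mult_zero_of_negative:
  fixes c :: "'a::unital_cstar_algebra"
  assumes neg: "hermitian_square (- (star c * c))"
  shows "star c * c = 0"
proof -
  define b where "b = c + star c"
  define d where "d = \<i> *\<^sub>C (c - star c)"
  have "selfadjoint b" by (simp add: b_def selfadjoint_def star_simps add.commute)
  moreover have "selfadjoint d"
  proof -
    have "star d = (- \<i>) *\<^sub>C (- (c - star c))" by (simp add: d_def star_simps)
    then show ?thesis by (simp only: d_def selfadjoint_def scaleC_minus_left scaleC_minus_right minus_minus)
  qed
  ultimately have "hermitian_square ((1/2) *\<^sub>R (b * b + d * d) + - (star c * c))"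
    by (intro hermitian_square_add hermitian_square_scaleR hermitian_squareI neg) auto
  moreover have "b * b + d * d = 2 *\<^sub>R (c * star c) + 2 *\<^sub>R (star c * c)"
    by (simp add: b_def d_def scaleC_mult_left scaleC_mult_right scaleC_diff_right scaleC_i_i algebra_simps scaleR_2)
  ultimately have "hermitian_square (c * star c)" by (simp add: scaleR_add_right)
  from hermitian_square_antisym[OF hermitian_square_star_mult_swap[OF this] neg] show ?thesis .
qed

text \<open>
  For \<open>h = a\<^sup>* a\<close> and \<open>r = \<bar>h\<bar>\<close> let \<open>p = r - h\<close>, twice the negative part of \<open>h\<close>. From
  \<open>p (r + h) = 0\<close> follows \<open>(a p)\<^sup>* (a p) = p h p = - p r p \<le> 0\<close>, so both sides vanish, hence
  \<open>p\<^sup>3 = p r p - p h p = 0\<close>, and \<open>p = 0\<close> means \<open>h = r\<close>.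
\<close>

lemma hermitian_square_star_mult:
  fixes a :: "'a::unital_cstar_algebra"
  shows "hermitian_square (star a * a)"
proof -
  define h where "h = star a * a"
  have h: "selfadjoint h" by (simp add: h_def selfadjoint_star_mult)
  obtain r where r: "hermitian_square r" "r * r = h * h" "\<And>z. z * (h * h) = (h * h) * z \<Longrightarrow> z * r = r * z"
    using hermitian_square_root[OF hermitian_squareI[OF h]] by metis
  have comm: "h * r = r * h" by (rule r(3)) (simp add: mult.assoc)
  define p where "p = r - h"
  have p: "selfadjoint p" using h r(1) by (simp add: p_def selfadjoint_diff hermitian_square_selfadjoint)
  have pr: "p * r = r * p" using comm by (simp add: p_def algebra_simps)
  have php: "p * h * p = - (p * r * p)"
  proof -
    have "p * (r + h) = 0" using r(2) comm by (simp add: p_def algebra_simps)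
    then have "p * (r + h) * p = 0" by simp
    then show ?thesis by (simp add: algebra_simps eq_neg_iff_add_eq_0)
  qed
  have cc: "star (a * p) * (a * p) = p * h * p"
    using p by (simp add: star_mult selfadjoint_def h_def mult.assoc)
  have "hermitian_square (- (star (a * p) * (a * p)))"
    unfolding cc php using hermitian_square_sandwich_commute[OF r(1) p pr] by simp
  then have "p * h * p = 0" using star_mult_zero_of_negative cc by metis
  then have "p * r * p - p * h * p = 0" using php by simp
  then have "p * p * p = 0" by (subst (2) p_def) (simp add: algebra_simps)
  then have "h = r" using selfadjoint_cube_zero[OF p] by (simp add: p_def)
  then show ?thesis using r(1) h_def by simp
qed

section \<open>The unitization as a C*-algebra\<close>

text \<open>
  A type of its own, since the product type already carries a norm that does not satisfy the
  C*-identity.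
\<close>

datatype 'a unitization = Unitization (base: 'a) (scalar: complex)

instantiation unitization :: (cstar_algebra) ring_1
begin

definition "0 = Unitization 0 0"
definition "1 = Unitization 0 1"
definition "u + v = Unitization (base u + base v) (scalar u + scalar v)"
definition "- u = Unitization (- base u) (- scalar u)"
definition "u - v = Unitization (base u - base v) (scalar u - scalar v)"
definition "u * v = Unitization
  (base u * base v + scalar u *\<^sub>C base v + scalar v *\<^sub>C base u) (scalar u * scalar v)"

instance
  by standard
    (simp_all add: zero_unitization_def one_unitization_def plus_unitization_def
      uminus_unitization_def minus_unitization_def times_unitization_def
      scaleC_add_right scaleC_add_left scaleC_mult_left scaleC_mult_right scaleC_scaleC scaleC_one
      scaleC_zero_right scaleC_zero_left algebra_simps)

end

lemma unitization_simps [simp]: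
  fixes u v :: "'a::cstar_algebra unitization"
  shows "base (0 :: 'a unitization) = 0" "scalar (0 :: 'a unitization) = 0"
    and "base (1 :: 'a unitization) = 0" "scalar (1 :: 'a unitization) = 1"
    and "base (u + v) = base u + base v" "scalar (u + v) = scalar u + scalar v"
    and "base (- u) = - base u" "scalar (- u) = - scalar u"
    and "base (u - v) = base u - base v" "scalar (u - v) = scalar u - scalar v"
    and "base (u * v) = base u * base v + scalar u *\<^sub>C base v + scalar v *\<^sub>C base u"
    and "scalar (u * v) = scalar u * scalar v"
  by (simp_all add: zero_unitization_def one_unitization_def plus_unitization_def
      uminus_unitization_def minus_unitization_def times_unitization_def)

lemma unitization_eq_iff: "u = v \<longleftrightarrow> base u = base v \<and> scalar u = scalar v"
  by (cases u; cases v) simp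

instantiation unitization :: (cstar_algebra) complex_vector
begin

definition "r *\<^sub>R u = Unitization (r *\<^sub>R base u) (complex_of_real r * scalar u)"
definition "c *\<^sub>C u = Unitization (c *\<^sub>C base u) (c * scalar u)"

instance
  by standard
    (simp_all add: unitization_eq_iff scaleR_unitization_def scaleC_unitization_def scaleC_scaleC scaleC_one
      scaleC_add_right scaleC_add_left scaleR_add_right scaleR_add_left scaleR_scaleC algebra_simps)

end

lemma unitization_scale_simps [simp]:
  "base (r *\<^sub>R u) = r *\<^sub>R base u" "scalar (r *\<^sub>R u) = complex_of_real r * scalar u"
  "base (c *\<^sub>C u) = c *\<^sub>C base u" "scalar (c *\<^sub>C u) = c * scalar u"
  by (simp_all add: scaleR_unitization_def scaleC_unitization_def)

text \<open>The algebra is an ideal of its unitization, which therefore acts on it from the left.\<close>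

definition left_action :: "'a::cstar_algebra unitization \<Rightarrow> 'a \<Rightarrow> 'a" where
  "left_action u x = base u * x + scalar u *\<^sub>C x"

lemma norm_left_action_le: "norm (left_action u x) \<le> norm x * (norm (base u) + cmod (scalar u))"
proof -
  have "norm (left_action u x) \<le> norm (base u * x) + norm (scalar u *\<^sub>C x)"
    unfolding left_action_def by (rule norm_triangle_ineq)
  also have "\<dots> \<le> norm (base u) * norm x + cmod (scalar u) * norm x"
    by (simp add: norm_mult_ineq norm_scaleC)
  finally show ?thesis by (simp add: algebra_simps)
qed

lemma bounded_linear_left_action: "bounded_linear (left_action u)"
proof (rule bounded_linear_intro)
  show "left_action u (x + y) = left_action u x + left_action u y" for x y
    by (simp add: left_action_def scaleC_add_right algebra_simps)
  show "left_action u (r *\<^sub>R x) = r *\<^sub>R left_action u x" for r x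
    by (simp add: left_action_def scaleC_add_right scaleR_scaleC scaleC_scaleC scaleC_mult_right mult.commute)
qed (rule norm_left_action_le)

lemma left_action_mult: "left_action (u * v) x = left_action u (left_action v x)"
  by (simp add: left_action_def scaleC_add_right scaleC_mult_left scaleC_mult_right scaleC_scaleC algebra_simps)

lemma left_action_add: "left_action (u + v) x = left_action u x + left_action v x"
  by (simp add: left_action_def scaleC_add_left algebra_simps)

instantiation unitization :: (cstar_algebra) real_normed_algebra_1
begin

text \<open>
  The operator norm of the left action alone is only a seminorm if the algebra has a unit \<open>e\<close>,
  because \<open>1 - e\<close> acts as \<open>0\<close>. The modulus of the scalar part is a C*-seminorm as well, and the
  maximum of the two is a C*-norm in all cases.
\<close>

definition "norm u = max (onorm (left_action u)) (cmod (scalar u))"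
definition "dist u v = norm (u - v :: 'a unitization)"
definition "sgn u = u /\<^sub>R norm (u :: 'a unitization)"
definition uniformity_unitization_def [code del]:
  "(uniformity :: ('a unitization \<times> 'a unitization) filter) =
    (INF e\<in>{0<..}. principal {(x, y). dist x y < e})"
definition open_unitization_def [code del]:
  "open (U :: 'a unitization set) \<longleftrightarrow>
    (\<forall>x\<in>U. eventually (\<lambda>(x', y). x' = x \<longrightarrow> y \<in> U) uniformity)"

instance
proof
  fix u v :: "'a unitization" and r :: real
  show "norm u = 0 \<longleftrightarrow> u = 0"
  proof
    assume "norm u = 0"
    then have "onorm (left_action u) \<le> 0" "cmod (scalar u) \<le> 0"
      by (simp_all add: norm_unitization_def max_def split: if_splits)
    then have 0: "scalar u = 0" "onorm (left_action u) = 0"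
      using onorm_pos_le[OF bounded_linear_left_action[of u]] by auto
    \<comment> \<open>with scalar part \<open>0\<close> the action is multiplication by \<open>base u\<close>, which is tested on \<open>(base u)\<^sup>*\<close>\<close>
    then have "left_action u (star (base u)) = 0"
      using onorm_eq_0[OF bounded_linear_left_action[of u]] by simp
    then have "star (star (base u)) * star (base u) = 0"
      using 0 by (simp add: left_action_def star_star scaleC_zero_left)
    then have "base u = 0" using cstar_identity[of "star (base u)"] by (simp add: norm_star)
    with 0 show "u = 0" by (simp add: unitization_eq_iff)
  next
    assume "u = 0"
    moreover have "left_action (0 :: 'a unitization) = (\<lambda>x. 0)"
      by (simp add: fun_eq_iff left_action_def scaleC_zero_left)
    ultimately show "norm u = 0" by (simp add: norm_unitization_def onorm_zero)
  qed
  show "norm (u + v) \<le> norm u + norm v"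
    using onorm_triangle[OF bounded_linear_left_action[of u] bounded_linear_left_action[of v]]
      norm_triangle_ineq[of "scalar u" "scalar v"]
    by (auto simp: norm_unitization_def left_action_add[abs_def] max_def)
  show "norm (r *\<^sub>R u) = \<bar>r\<bar> * norm u"
  proof -
    have "left_action (r *\<^sub>R u) = (\<lambda>x. r *\<^sub>R left_action u x)"
      by (simp add: fun_eq_iff left_action_def scaleC_add_right scaleR_scaleC scaleC_scaleC scaleC_mult_left)
    then show ?thesis
      by (simp add: norm_unitization_def onorm_scaleR[OF bounded_linear_left_action] norm_mult max_mult_distrib_left)
  qed
  show "norm (u * v) \<le> norm u * norm v"
  proof -
    have "onorm (left_action (u * v)) \<le> onorm (left_action u) * onorm (left_action v)"
      using onorm_compose[OF bounded_linear_left_action[of u] bounded_linear_left_action[of v]]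
      by (simp add: left_action_mult[abs_def] comp_def)
    also have "\<dots> \<le> norm u * norm v"
      by (intro mult_mono) (auto simp: norm_unitization_def onorm_pos_le[OF bounded_linear_left_action] le_max_iff_disj)
    finally have "onorm (left_action (u * v)) \<le> norm u * norm v" .
    moreover have "cmod (scalar (u * v)) \<le> norm u * norm v"
      unfolding unitization_simps norm_mult
      by (intro mult_mono) (auto simp: norm_unitization_def le_max_iff_disj)
    ultimately show ?thesis by (simp add: norm_unitization_def[of "u * v"])
  qed
  show "norm (1 :: 'a unitization) = 1"
  proof -
    have "left_action (1 :: 'a unitization) = (\<lambda>x. x)" by (auto simp: left_action_def scaleC_one)
    then show ?thesis using onorm_id_le[where 'a = 'a] by (simp add: norm_unitization_def)
  qed
qed (simp_all add: dist_unitization_def sgn_unitization_def uniformity_unitization_def open_unitization_def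
      unitization_eq_iff scaleC_mult_left scaleC_mult_right scaleR_scaleC scaleC_add_right scaleC_scaleC mult.commute)

end

lemma norm_scalar_le: "cmod (scalar u) \<le> norm (u :: 'a::cstar_algebra unitization)"
  by (simp add: norm_unitization_def)

lemma norm_left_action: "norm (left_action u x) \<le> norm u * norm x"
proof -
  have "norm (left_action u x) \<le> onorm (left_action u) * norm x"
    by (rule onorm[OF bounded_linear_left_action])
  also have "\<dots> \<le> norm u * norm x" by (intro mult_right_mono) (simp_all add: norm_unitization_def)
  finally show ?thesis .
qed

lemma norm_unitization_le:
  assumes "\<And>x. norm (left_action u x) \<le> K * norm x" "cmod (scalar u) \<le> K"
  shows "norm u \<le> K"
  using assms onorm_bound[of K "left_action u"] norm_ge_zero[of "scalar u"]
  by (auto simp: norm_unitization_def intro: order_trans)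

definition embed :: "'a::cstar_algebra \<Rightarrow> 'a unitization" where
  "embed x = Unitization x 0"

lemma embed_simps [simp]: "base (embed x) = x" "scalar (embed x) = 0"
  by (simp_all add: embed_def)

lemma embed_of_scalar_zero: "scalar u = 0 \<Longrightarrow> u = embed (base u)"
  by (simp add: unitization_eq_iff)

lemma embed_inject: "embed x = embed y \<longleftrightarrow> x = y"
  and embed_add: "embed (x + y) = embed x + embed y"
  and embed_diff: "embed (x - y) = embed x - embed y"
  and embed_scaleR: "embed (r *\<^sub>R x) = r *\<^sub>R embed x"
  and embed_mult: "embed (x * y) = embed x * embed y"
  by (simp_all add: unitization_eq_iff scaleC_zero_left)

lemma left_action_embed: "left_action (embed a) x = a * x"
  by (simp add: left_action_def scaleC_zero_left)

lemma norm_embed: "norm (embed a) = norm a"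
proof (rule antisym)
  show "norm (embed a) \<le> norm a"
    by (rule norm_unitization_le) (simp_all add: left_action_embed norm_mult_ineq)
  have "norm (a * star a) \<le> norm (embed a) * norm (star a)"
    using norm_left_action[of "embed a" "star a"] by (simp add: left_action_embed)
  moreover have "norm (a * star a) = norm a * norm (star a)"
    using cstar_identity[of "star a"] by (simp add: star_star norm_star power2_eq_square)
  ultimately show "norm a \<le> norm (embed a)"
    by (cases "a = 0") (simp_all add: norm_star)
qed

text \<open>
  Both components of a Cauchy sequence are Cauchy: the scalar part is a contraction, and
  \<open>base u = u - scalar u 1\<close> has at most twice the norm of \<open>u\<close>.
\<close>

instance unitization :: (cstar_algebra) banach
proof
  fix X :: "nat \<Rightarrow> 'a unitization" assume X: "Cauchy X"
  have "Cauchy (\<lambda>n. scalar (X n))"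
  proof (rule metric_CauchyI)
    fix e :: real assume "e > 0"
    then obtain M where M: "\<And>m n. m \<ge> M \<Longrightarrow> n \<ge> M \<Longrightarrow> dist (X m) (X n) < e"
      using metric_CauchyD[OF X] by blast
    have "dist (scalar (X m)) (scalar (X n)) \<le> dist (X m) (X n)" for m n
      using norm_scalar_le[of "X m - X n"] by (simp add: dist_norm)
    then show "\<exists>M. \<forall>m\<ge>M. \<forall>n\<ge>M. dist (scalar (X m)) (scalar (X n)) < e"
      using M order_le_less_trans by blast
  qed
  then obtain l where l: "(\<lambda>n. scalar (X n)) \<longlonglongrightarrow> l" using Cauchy_convergent convergent_def by blast
  have split: "u = embed (base u) + scalar u *\<^sub>C 1" for u :: "'a unitization"
    by (simp add: unitization_eq_iff scaleC_zero_right)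
  have scal: "norm (c *\<^sub>C (1 :: 'a unitization)) \<le> cmod c" for c
    by (rule norm_unitization_le)
       (simp_all add: left_action_def norm_scaleC scaleC_zero_right)
  have "Cauchy (\<lambda>n. base (X n))"
  proof (rule metric_CauchyI)
    fix e :: real assume "e > 0"
    then obtain M where M: "\<And>m n. m \<ge> M \<Longrightarrow> n \<ge> M \<Longrightarrow> dist (X m) (X n) < e / 2"
      using metric_CauchyD[OF X, of "e / 2"] by auto
    have "dist (base (X m)) (base (X n)) < e" if mn: "m \<ge> M" "n \<ge> M" for m n
    proof -
      define u where "u = X m - X n"
      have "embed (base u) = u - scalar u *\<^sub>C 1"
        by (simp add: unitization_eq_iff scaleC_zero_right)
      then have "norm (base u) \<le> norm u + norm (scalar u *\<^sub>C (1 :: 'a unitization))"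
        using norm_triangle_ineq4[of u "scalar u *\<^sub>C 1"] by (metis norm_embed)
      also have "\<dots> \<le> norm u + norm u"
        using scal[of "scalar u"] norm_scalar_le[of u] by linarith
      also have "\<dots> < e" using M[OF mn] by (simp add: u_def dist_norm)
      finally show ?thesis by (simp add: u_def dist_norm)
    qed
    then show "\<exists>M. \<forall>m\<ge>M. \<forall>n\<ge>M. dist (base (X m)) (base (X n)) < e" by blast
  qed
  then obtain b where b: "(\<lambda>n. base (X n)) \<longlonglongrightarrow> b" using Cauchy_convergent convergent_def by blast
  have bound: "norm (X n - Unitization b l) \<le> norm (base (X n) - b) + cmod (scalar (X n) - l)" for n
  proof -
    have "X n - Unitization b l = embed (base (X n) - b) + (scalar (X n) - l) *\<^sub>C 1"
      by (simp add: unitization_eq_iff scaleC_zero_right)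
    then show ?thesis
      using norm_triangle_ineq[of "embed (base (X n) - b)" "(scalar (X n) - l) *\<^sub>C 1"]
        scal[of "scalar (X n) - l"] by (simp add: norm_embed)
  qed
  have lim: "(\<lambda>n. norm (base (X n) - b) + cmod (scalar (X n) - l)) \<longlonglongrightarrow> 0"
    using tendsto_add[OF tendsto_norm_zero[OF LIM_zero[OF b]] tendsto_norm_zero[OF LIM_zero[OF l]]] by simp
  have "(\<lambda>n. norm (X n - Unitization b l)) \<longlonglongrightarrow> 0"
    by (rule tendsto_sandwich[OF _ _ tendsto_const lim]) (simp_all add: bound)
  then have "(\<lambda>n. X n - Unitization b l) \<longlonglongrightarrow> 0" by (rule tendsto_norm_zero_cancel)
  then have "X \<longlonglongrightarrow> Unitization b l" by (rule LIM_zero_cancel)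
  then show "convergent X" by (auto simp: convergent_def)
qed

instantiation unitization :: (cstar_algebra) unital_cstar_algebra
begin

definition "star u = Unitization (star (base u)) (cnj (scalar u))"

instance
proof
  fix u v :: "'a unitization" and c :: complex
  note [simp] = star_unitization_def
  show "norm (c *\<^sub>C u) = cmod c * norm u"
  proof (cases "c = 0")
    case True
    then show ?thesis by (simp add: scaleC_zero_left)
  next
    case False
    \<comment> \<open>equality follows from \<open>\<le>\<close>, applied to \<open>c\<close> and to \<open>1 / c\<close>\<close>
    have la: "norm (left_action (d *\<^sub>C w) x) = cmod d * norm (left_action w x)" for d x and w :: "'a unitization"
      by (simp add: left_action_def scaleC_mult_left flip: scaleC_scaleC scaleC_add_right norm_scaleC)
    have le: "norm (d *\<^sub>C w) \<le> cmod d * norm w" for d and w :: "'a unitization"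
      by (rule norm_unitization_le)
         (simp_all add: la norm_mult mult_left_mono norm_left_action norm_scalar_le mult.assoc)
    have "norm u = norm ((1/c) *\<^sub>C c *\<^sub>C u)" using False by (simp add: scaleC_scaleC scaleC_one)
    also have "\<dots> \<le> cmod (1/c) * norm (c *\<^sub>C u)" by (rule le)
    finally have "cmod c * norm u \<le> norm (c *\<^sub>C u)" using False by (simp add: norm_divide field_simps)
    with le[of c u] show ?thesis by simp
  qed
  have star_mult': "star (w * z) = star z * star w" and star_star': "star (star w) = w" for w z :: "'a unitization"
    by (simp_all add: unitization_eq_iff star_simps algebra_simps)
  show "star (u * v) = star v * star u" "star (star u) = u"
    by (fact star_mult' star_star')+
  \<comment> \<open>the essential half of the C*-identity, from \<open>\<parallel>w x\<parallel>\<^sup>2 = \<parallel>x\<^sup>* (w\<^sup>* w x)\<parallel>\<close>; it implies that \<open>star\<close> is isometric\<close>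
  have le: "(norm w)\<^sup>2 \<le> norm (star w * w)" for w :: "'a unitization"
  proof -
    define K where "K = sqrt (norm (star w * w))"
    have act: "(norm (left_action w x))\<^sup>2 \<le> norm (star w * w) * (norm x)\<^sup>2" for x
    proof -
      have "star (left_action w x) * left_action w x = star x * left_action (star w * w) x"
        by (simp add: left_action_def star_simps scaleC_mult_left scaleC_mult_right scaleC_scaleC
            scaleC_add_right algebra_simps)
      then have "(norm (left_action w x))\<^sup>2 = norm (star x * left_action (star w * w) x)"
        by (metis cstar_identity)
      also have "\<dots> \<le> norm (star x) * norm (left_action (star w * w) x)" by (rule norm_mult_ineq)
      also have "\<dots> \<le> norm x * (norm (star w * w) * norm x)"
        unfolding norm_star by (intro mult_left_mono norm_left_action) simp
      finally show ?thesis by (simp add: power2_eq_square algebra_simps)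
    qed
    have "norm w \<le> K"
    proof (rule norm_unitization_le)
      show "norm (left_action w x) \<le> K * norm x" for x
        using real_le_rsqrt[OF act[of x]] by (simp add: K_def real_sqrt_mult)
      have "(cmod (scalar w))\<^sup>2 \<le> norm (star w * w)"
        using norm_scalar_le[of "star w * w"] by (simp add: norm_mult power2_eq_square)
      then show "cmod (scalar w) \<le> K" unfolding K_def by (rule real_le_rsqrt)
    qed
    then have "(norm w)\<^sup>2 \<le> K\<^sup>2" by (rule power_mono) simp
    then show ?thesis by (simp add: K_def)
  qed
  have star_le: "norm w \<le> norm (star w)" for w :: "'a unitization"
  proof (cases "w = 0")
    case False
    have "norm w * norm w \<le> norm (star w) * norm w"
      using le[of w] norm_mult_ineq[of "star w" w] by (simp add: power2_eq_square)
    with False show ?thesis by simp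
  qed simp
  have "norm (star u) = norm u" using star_le[of u] star_le[of "star u"] by (simp only: star_star')
  then show "norm (star u * u) = (norm u)\<^sup>2"
    using le[of u] norm_mult_ineq[of "star u" u] by (simp add: power2_eq_square)
qed (simp_all add: unitization_eq_iff star_unitization_def star_simps scaleC_mult_left scaleC_mult_right
      scaleC_add_right scaleC_scaleC mult.commute mult.left_commute)

end

lemma embed_star: "embed (star x) = star (embed x)"
  by (simp add: unitization_eq_iff star_unitization_def)

lemma selfadjoint_embed: "selfadjoint (embed x) \<longleftrightarrow> selfadjoint x"
  by (simp add: selfadjoint_def embed_inject flip: embed_star)

lemma unitization_invertible_iff:
  "unitization_invertible u \<longleftrightarrow> two_sided_unit (Unitization (fst u) (snd u))"
proof -
  have "Unitization (fst u) (snd u) * Unitization (fst v) (snd v) = 1 \<longleftrightarrow> unitization_mult u v = (0, 1)" for u v :: "'a \<times> complex"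
    by (simp add: unitization_mult_def unitization_eq_iff)
  then show ?thesis unfolding unitization_invertible_def two_sided_unit_def
    by (metis unitization.collapse fst_conv snd_conv)
qed

section \<open>The order of a C*-algebra\<close>

text \<open>
  The bridge between spectral positivity and squares; invertibility of \<open>a - z\<close>, by which the
  spectrum is defined, is invertibility in the type of the unitization.
\<close>

lemma positive_iff_hermitian_square_embed: "positive a \<longleftrightarrow> hermitian_square (embed a)"
proof
  have shift: "Unitization a (- z) = embed a - z *\<^sub>C 1" for z
    by (simp add: unitization_eq_iff scaleC_zero_right)
  {
    assume pos: "positive a"
    show "hermitian_square (embed a)"
    proof (rule hermitian_square_of_units)
      show "selfadjoint (embed a)" using pos by (simp add: positive_def selfadjoint_embed)
      fix s :: real assume "s > 0"
      then have "complex_of_real (- s) \<notin> spectrum a"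
        using pos by (auto simp: positive_def simp del: of_real_minus)
      then have "two_sided_unit (embed a - complex_of_real (- s) *\<^sub>C 1)"
        by (simp add: spectrum_def unitization_invertible_iff flip: shift)
      then show "two_sided_unit (embed a + s *\<^sub>R 1)" unfolding scaleC_of_real by simp
    qed
  next
    assume sq: "hermitian_square (embed a)"
    then have "z \<notin> spectrum a" if "z \<notin> complex_of_real ` {0..}" for z
      using hermitian_square_resolvent[OF sq that] by (simp add: spectrum_def unitization_invertible_iff shift)
    then show "positive a"
      using hermitian_square_selfadjoint[OF sq] by (auto simp: positive_def selfadjoint_embed)
  }
qed

lemma positive_imp_selfadjoint: "positive a \<Longrightarrow> selfadjoint a"
  by (simp add: positive_def)

lemma positive_square:
  assumes "selfadjoint (x :: 'a::cstar_algebra)" shows "positive (x * x)"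
  unfolding positive_iff_hermitian_square_embed embed_mult
  by (rule hermitian_squareI) (simp add: selfadjoint_embed assms)

lemma positive_zero: "positive (0 :: 'a::cstar_algebra)"
  using positive_square[of 0] by simp

lemma positive_add: "positive a \<Longrightarrow> positive b \<Longrightarrow> positive (a + b :: 'a::cstar_algebra)"
  by (simp add: positive_iff_hermitian_square_embed embed_add hermitian_square_add)

lemma positive_scaleR: "positive a \<Longrightarrow> 0 \<le> t \<Longrightarrow> positive (t *\<^sub>R a :: 'a::cstar_algebra)"
  by (simp add: positive_iff_hermitian_square_embed embed_scaleR hermitian_square_scaleR)

lemma positive_sum:
  "(\<And>i. i \<in> I \<Longrightarrow> positive (f i)) \<Longrightarrow> positive (sum f I :: 'a::cstar_algebra)"
  by (induction I rule: infinite_finite_induct) (simp_all add: positive_zero positive_add)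

lemma positive_star_mult: "positive (star a * a :: 'a::cstar_algebra)"
  by (simp add: positive_iff_hermitian_square_embed embed_mult embed_star hermitian_square_star_mult)

lemma positive_norm_mono:
  "positive a \<Longrightarrow> positive (b - a) \<Longrightarrow> norm a \<le> norm (b :: 'a::cstar_algebra)"
  using norm_mono_hermitian_square[of "embed a" "embed b"]
  by (simp add: positive_iff_hermitian_square_embed embed_diff norm_embed)

text \<open>
  In the unitization \<open>h \<le> \<parallel>h\<parallel> 1\<close>, so a perturbation by \<open>\<epsilon> h\<close> is dominated by one by a small
  multiple of \<open>1\<close>.
\<close>

lemma positive_archimedean:
  fixes b h :: "'a::cstar_algebra"
  assumes b: "selfadjoint b" and h: "selfadjoint h"
    and eps: "\<And>\<epsilon>. \<epsilon> > 0 \<Longrightarrow> positive (b + \<epsilon> *\<^sub>R h)"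
  shows "positive b"
  unfolding positive_iff_hermitian_square_embed
proof (rule hermitian_square_archimedean)
  show "selfadjoint (embed b)" using b by (simp add: selfadjoint_embed)
  fix \<epsilon> :: real assume e: "\<epsilon> > 0"
  define \<delta> where "\<delta> = \<epsilon> / (norm h + 1)"
  have pos: "norm h + 1 > 0" using norm_ge_zero[of h] by linarith
  then have d: "\<delta> > 0" using e by (simp add: \<delta>_def)
  have "hermitian_square (embed b + \<delta> *\<^sub>R embed h)"
    using eps[OF d] by (simp add: positive_iff_hermitian_square_embed embed_add embed_scaleR)
  moreover have "\<delta> * norm h \<le> \<epsilon>"
    using pos e by (simp add: \<delta>_def field_simps)
  then have "hermitian_square (\<epsilon> *\<^sub>R 1 - \<delta> *\<^sub>R embed h)"
    using h d by (intro hermitian_square_norm_bound_diff) (simp_all add: selfadjoint_scaleR selfadjoint_embed norm_embed)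
  ultimately have "hermitian_square ((embed b + \<delta> *\<^sub>R embed h) + (\<epsilon> *\<^sub>R 1 - \<delta> *\<^sub>R embed h))"
    by (rule hermitian_square_add)
  then show "hermitian_square (embed b + \<epsilon> *\<^sub>R 1)" by simp
qed

text \<open>
  In the unitization \<open>s1 - g = q\<^sup>2\<close>, and \<open>c\<^sup>* (s1 - g) c = (q c)\<^sup>* (q c)\<close>.
\<close>

lemma positive_conjugation_norm_bound:
  fixes g c :: "'a::cstar_algebra"
  assumes g: "selfadjoint g" and s: "norm g \<le> s"
  shows "positive (s *\<^sub>R (star c * c) - star c * g * c)"
proof -
  have "hermitian_square (s *\<^sub>R 1 - embed g)"
    using g s by (intro hermitian_square_norm_bound_diff) (simp_all add: selfadjoint_embed norm_embed)
  then obtain q where q: "selfadjoint q" "s *\<^sub>R 1 - embed g = q * q"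
    by (auto simp: hermitian_square_def)
  have "embed (s *\<^sub>R (star c * c) - star c * g * c) = star (embed c) * (s *\<^sub>R 1 - embed g) * embed c"
    by (simp add: embed_diff embed_scaleR embed_mult embed_star left_diff_distrib right_diff_distrib)
  also have "\<dots> = star (q * embed c) * (q * embed c)"
    using q by (simp add: star_mult selfadjoint_def mult.assoc)
  finally show ?thesis by (simp add: positive_iff_hermitian_square_embed hermitian_square_star_mult)
qed

text \<open>
  The root taken in the unitization lies in the algebra because the square of its scalar part is
  \<open>0\<close>. With uniqueness, the description defining the square root refers to an actual element.
\<close>

lemma square_positive_sqrt:
  fixes a :: "'a::cstar_algebra"
  assumes a: "positive a"
  shows "square (positive_sqrt a) = a"
proof -
  obtain r where r: "hermitian_square r" "r * r = embed a"
    using a hermitian_square_root unfolding positive_iff_hermitian_square_embed by metis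
  have "scalar r * scalar r = 0" using arg_cong[OF r(2), of scalar] by simp
  then have rb: "r = embed (base r)" by (intro embed_of_scalar_zero) simp
  have "positive (base r) \<and> base r * base r = a"
    using r rb unfolding positive_iff_hermitian_square_embed by (metis embed_mult embed_inject)
  moreover have "b = c" if "positive b \<and> b * b = a" "positive c \<and> c * c = a" for b c
    using hermitian_square_root_unique[of "embed b" "embed c"] that
    by (simp add: positive_iff_hermitian_square_embed embed_inject flip: embed_mult)
  ultimately have "\<exists>!b. positive b \<and> b * b = a" by blast
  then show ?thesis unfolding positive_sqrt_def by (rule theI'[THEN conjunct2])
qed

text \<open>
  Cauchy-Schwarz in algebraic form, for the Gram matrix with diagonal entries \<open>g\<close>, \<open>h\<close> and
  off-diagonal entries \<open>c\<close>, \<open>c\<^sup>*\<close>. If \<open>s \<ge> \<parallel>g\<parallel>\<close> and \<open>s > 0\<close>, then taking \<open>a = c / s\<close> and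
  bounding \<open>a\<^sup>* g a\<close> by \<open>s a\<^sup>* a\<close> gives \<open>c\<^sup>* c \<le> s h\<close>. Using \<open>s = \<parallel>g\<parallel> + \<epsilon>\<close> and letting
  \<open>\<epsilon>\<close> tend to \<open>0\<close> includes the degenerate case \<open>g = 0\<close>.
\<close>

lemma cauchy_schwarz_of_positive_quadratic:
  fixes g c h :: "'a::cstar_algebra"
  assumes g: "selfadjoint g" and h: "selfadjoint h"
    and pos: "\<And>a. positive (star a * g * a - star a * c - star c * a + h)"
  shows "positive (norm g *\<^sub>R h - star c * c)"
proof (rule positive_archimedean)
  show "selfadjoint (norm g *\<^sub>R h - star c * c)"
    using h by (simp add: selfadjoint_diff selfadjoint_scaleR selfadjoint_star_mult)
  show "selfadjoint h" by (fact h)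
  fix \<epsilon> :: real assume "\<epsilon> > 0"
  define s where "s = norm g + \<epsilon>"
  have s: "s > 0" "norm g \<le> s" using \<open>\<epsilon> > 0\<close> norm_ge_zero[of g] by (simp_all add: s_def add_nonneg_pos)
  define t where "t = 1 / s"
  have t: "t > 0" "s * t = 1" using s by (simp_all add: t_def)
  have "positive (s *\<^sub>R (star (t *\<^sub>R c) * (t *\<^sub>R c)) - star (t *\<^sub>R c) * g * (t *\<^sub>R c)
      + (star (t *\<^sub>R c) * g * (t *\<^sub>R c) - star (t *\<^sub>R c) * c - star c * (t *\<^sub>R c) + h))"
    by (intro positive_add pos positive_conjugation_norm_bound g s)
  also have "s *\<^sub>R (star (t *\<^sub>R c) * (t *\<^sub>R c)) - star (t *\<^sub>R c) * g * (t *\<^sub>R c)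
      + (star (t *\<^sub>R c) * g * (t *\<^sub>R c) - star (t *\<^sub>R c) * c - star c * (t *\<^sub>R c) + h)
    = h - t *\<^sub>R (star c * c)"
    using t by (simp add: star_scaleR)
  finally have "positive (s *\<^sub>R (h - t *\<^sub>R (star c * c)))" using s by (intro positive_scaleR) simp_all
  also have "s *\<^sub>R (h - t *\<^sub>R (star c * c)) = norm g *\<^sub>R h - star c * c + \<epsilon> *\<^sub>R h"
    using t by (simp add: scaleR_right_diff_distrib) (simp add: s_def scaleR_add_left)
  finally show "positive (norm g *\<^sub>R h - star c * c + \<epsilon> *\<^sub>R h)" .
qed

section \<open>The covariance as a semi-inner product\<close>

definition weighted_covariance ::
    "('x \<Rightarrow> 'x \<Rightarrow> 'a::real_vector) \<Rightarrow> (nat \<Rightarrow> real) \<Rightarrow> nat set \<Rightarrow> (nat \<Rightarrow> 'x::real_vector) \<Rightarrow> (nat \<Rightarrow> 'x) \<Rightarrow> 'a" where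
  "weighted_covariance ip p I x y =
     (\<Sum>i\<in>I. p i *\<^sub>R ip (x i) (y i)) - ip (\<Sum>i\<in>I. p i *\<^sub>R x i) (\<Sum>i\<in>I. p i *\<^sub>R y i)"

context semi_inner_product_module
begin

lemma ip_add_left: "ip (x + y) z = ip x z + ip y z"
  using arg_cong[OF ip_add_right[of z x y], of star] by (simp add: star_ip star_add)

lemma ip_zero [simp]: "ip x 0 = 0" "ip 0 x = 0"
  using ip_add_right[of x 0 0] ip_add_left[of 0 0 x] by simp_all

lemma ip_diff_right: "ip x (y - z) = ip x y - ip x z"
  using ip_add_right[of x "y - z" z] by simp

lemma ip_diff_left: "ip (x - y) z = ip x z - ip y z"
  using ip_add_left[of "x - y" y z] by simp

lemma ip_act_left: "ip (act x c) y = star c * ip x y"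
  using arg_cong[OF ip_act_right[of y x c], of star] by (simp add: star_ip star_mult)

text \<open>
  Homogeneity is a consequence of the compatibility of scalars with the action:
  multiplied on the right by any algebra element, the two sides agree, so their difference \<open>d\<close>
  satisfies \<open>d d\<^sup>* = 0\<close>.
\<close>

lemma ip_scaleR_right: "ip x (r *\<^sub>R y) = r *\<^sub>R ip x y"
proof -
  define d where "d = ip x (r *\<^sub>R y) - r *\<^sub>R ip x y"
  have "ip x (r *\<^sub>R y) * c = r *\<^sub>R ip x y * c" for c
  proof -
    have "ip x (r *\<^sub>R y) * c = ip x (act y (r *\<^sub>R c))"
      by (simp add: scaleR_scaleC act_scaleC_left act_scaleC_right flip: ip_act_right)
    then show ?thesis by (simp add: ip_act_right)
  qed
  then have "star (star d) * star d = 0" by (simp add: d_def star_star left_diff_distrib)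
  then have "d = 0" using cstar_identity[of "star d"] by (simp add: norm_star)
  then show ?thesis by (simp add: d_def)
qed

lemma ip_scaleR_left: "ip (r *\<^sub>R x) y = r *\<^sub>R ip x y"
  using arg_cong[OF ip_scaleR_right[of y r x], of star] by (simp add: star_ip star_scaleR)

lemma ip_sum_right: "ip x (\<Sum>i\<in>I. f i) = (\<Sum>i\<in>I. ip x (f i))"
  by (induction I rule: infinite_finite_induct) (simp_all add: ip_add_right)

lemma ip_sum_left: "ip (\<Sum>i\<in>I. f i) x = (\<Sum>i\<in>I. ip (f i) x)"
  by (induction I rule: infinite_finite_induct) (simp_all add: ip_add_left)

lemma act_weighted_sum: "act (\<Sum>i\<in>I. p i *\<^sub>R f i) c = (\<Sum>i\<in>I. p i *\<^sub>R act (f i) c)"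
proof -
  have "act 0 c = 0" using act_add_left[of 0 0 c] by simp
  then show ?thesis
    by (induction I rule: infinite_finite_induct)
       (simp_all add: act_add_left scaleR_scaleC act_scaleC_left)
qed

lemma star_weighted_covariance:
  "star (weighted_covariance ip p I x y) = weighted_covariance ip p I y x"
proof -
  have "star (\<Sum>i\<in>I. p i *\<^sub>R ip (x i) (y i)) = (\<Sum>i\<in>I. p i *\<^sub>R ip (y i) (x i))"
    by (induction I rule: infinite_finite_induct) (simp_all add: star_simps star_ip)
  then show ?thesis by (simp add: weighted_covariance_def star_diff star_ip)
qed

text \<open>
  Because the weights add up to \<open>1\<close>, the terms introduced by \<open>a\<close> and \<open>b\<close> are the same in the
  average of the inner products as in the inner product of the averages.
\<close>

lemma weighted_covariance_translate:
  assumes p: "(\<Sum>i\<in>I. p i) = 1"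
  shows "(\<Sum>i\<in>I. p i *\<^sub>R ip (x i - a) (y i - b))
      - ip ((\<Sum>i\<in>I. p i *\<^sub>R x i) - a) ((\<Sum>i\<in>I. p i *\<^sub>R y i) - b)
      = weighted_covariance ip p I x y"
proof -
  define m k where "m = (\<Sum>i\<in>I. p i *\<^sub>R x i)" and "k = (\<Sum>i\<in>I. p i *\<^sub>R y i)"
  have "(\<Sum>i\<in>I. p i *\<^sub>R ip (x i - a) (y i - b))
      = (\<Sum>i\<in>I. p i *\<^sub>R ip (x i) (y i)) - (\<Sum>i\<in>I. p i *\<^sub>R ip (x i) b)
        - (\<Sum>i\<in>I. p i *\<^sub>R ip a (y i)) + (\<Sum>i\<in>I. p i *\<^sub>R ip a b)"
    by (simp add: ip_diff_left ip_diff_right sum.distrib sum_subtractf algebra_simps)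
  also have "(\<Sum>i\<in>I. p i *\<^sub>R ip a b) = ip a b" using p by (simp flip: scaleR_left.sum)
  also have "(\<Sum>i\<in>I. p i *\<^sub>R ip (x i) b) = ip m b"
    by (simp add: m_def ip_sum_left ip_scaleR_left)
  also have "(\<Sum>i\<in>I. p i *\<^sub>R ip a (y i)) = ip a k"
    by (simp add: k_def ip_sum_right ip_scaleR_right)
  finally show "(\<Sum>i\<in>I. p i *\<^sub>R ip (x i - a) (y i - b))
      - ip ((\<Sum>i\<in>I. p i *\<^sub>R x i) - a) ((\<Sum>i\<in>I. p i *\<^sub>R y i) - b)
      = weighted_covariance ip p I x y"
    by (simp add: weighted_covariance_def ip_diff_left ip_diff_right flip: m_def k_def)
qed

text \<open>Translating by the mean makes the subtracted inner product vanish.\<close>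

lemma positive_weighted_covariance:
  assumes "\<And>i. i \<in> I \<Longrightarrow> 0 \<le> p i" and "(\<Sum>i\<in>I. p i) = 1"
  shows "positive (weighted_covariance ip p I z z)"
proof -
  have "weighted_covariance ip p I z z
      = (\<Sum>i\<in>I. p i *\<^sub>R ip (z i - (\<Sum>i\<in>I. p i *\<^sub>R z i)) (z i - (\<Sum>i\<in>I. p i *\<^sub>R z i)))"
    using weighted_covariance_translate[OF assms(2), of z "\<Sum>i\<in>I. p i *\<^sub>R z i" z "\<Sum>i\<in>I. p i *\<^sub>R z i"]
    by simp
  then show ?thesis using assms by (simp add: positive_sum positive_scaleR ip_positive)
qed

lemma weighted_covariance_quadratic:
  "weighted_covariance ip p I (\<lambda>i. act (x i) c - y i) (\<lambda>i. act (x i) c - y i)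
    = star c * weighted_covariance ip p I x x * c - star c * weighted_covariance ip p I x y
      - weighted_covariance ip p I y x * c + weighted_covariance ip p I y y"
proof -
  have q: "ip (act u c - v) (act u c - v) = star c * ip u u * c - star c * ip u v - ip v u * c + ip v v" for u v
    by (simp add: ip_diff_left ip_diff_right ip_act_left ip_act_right left_diff_distrib mult.assoc)
  have mean: "(\<Sum>i\<in>I. p i *\<^sub>R (act (x i) c - y i)) = act (\<Sum>i\<in>I. p i *\<^sub>R x i) c - (\<Sum>i\<in>I. p i *\<^sub>R y i)"
    by (simp add: scaleR_right_diff_distrib sum_subtractf act_weighted_sum)
  show ?thesis
    unfolding weighted_covariance_def mean q
    by (simp add: algebra_simps sum.distrib sum_subtractf sum_distrib_left sum_distrib_right)
qed

lemma weighted_covariance_cauchy_schwarz: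
  fixes x y :: "nat \<Rightarrow> 'x"
  assumes "\<And>i. i \<in> I \<Longrightarrow> 0 \<le> p i" and "(\<Sum>i\<in>I. p i) = 1"
  shows "positive (norm (weighted_covariance ip p I x x) *\<^sub>R weighted_covariance ip p I y y
    - star (weighted_covariance ip p I x y) * weighted_covariance ip p I x y)"
proof (rule cauchy_schwarz_of_positive_quadratic)
  show "selfadjoint (weighted_covariance ip p I x x)" "selfadjoint (weighted_covariance ip p I y y)"
    by (simp_all add: selfadjoint_def star_weighted_covariance)
  fix c
  show "positive (star c * weighted_covariance ip p I x x * c - star c * weighted_covariance ip p I x y
      - star (weighted_covariance ip p I x y) * c + weighted_covariance ip p I y y)"
    using positive_weighted_covariance[OF assms, of "\<lambda>i. act (x i) c - y i"]
    by (simp only: weighted_covariance_quadratic star_weighted_covariance)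
qed

end

theorem theorem4:
  fixes act :: "'x::complex_vector \<Rightarrow> 'a::cstar_algebra \<Rightarrow> 'x"
    and ip :: "'x \<Rightarrow> 'x \<Rightarrow> 'a"
    and a b :: 'x
    and n :: nat
    and p :: "nat \<Rightarrow> real"
    and x y :: "nat \<Rightarrow> 'x"
  assumes "semi_inner_product_module act ip"
    and "probability_vector n p"
  shows
    "square (cstar_abs ((\<Sum>i=1..n. p i *\<^sub>R ip (x i) (y i))
          - ip (\<Sum>i=1..n. p i *\<^sub>R x i) (\<Sum>i=1..n. p i *\<^sub>R y i)))
       \<preceq> norm ((\<Sum>i=1..n. p i *\<^sub>R square (module_abs ip (x i - a)))
              - square (module_abs ip ((\<Sum>i=1..n. p i *\<^sub>R x i) - a)))
           *\<^sub>R ((\<Sum>i=1..n. p i *\<^sub>R square (module_abs ip (y i - b)))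
              - square (module_abs ip ((\<Sum>i=1..n. p i *\<^sub>R y i) - b)))
     \<and>
     norm ((\<Sum>i=1..n. p i *\<^sub>R square (module_abs ip (x i - a)))
              - square (module_abs ip ((\<Sum>i=1..n. p i *\<^sub>R x i) - a)))
           *\<^sub>R ((\<Sum>i=1..n. p i *\<^sub>R square (module_abs ip (y i - b)))
              - square (module_abs ip ((\<Sum>i=1..n. p i *\<^sub>R y i) - b)))
       \<preceq> (\<Sum>i=1..n. p i * (module_norm ip (x i - a))\<^sup>2)
           *\<^sub>R (\<Sum>i=1..n. p i *\<^sub>R square (module_abs ip (y i - b)))"
proof -
  interpret semi_inner_product_module act ip by fact
  have p0: "\<And>i. i \<in> {1..n} \<Longrightarrow> 0 \<le> p i" and p1: "(\<Sum>i=1..n. p i) = 1"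
    using assms(2) by (auto simp: probability_vector_def)
  have mod_sq: "square (module_abs ip z) = ip z z" for z
    unfolding module_abs_def by (rule square_positive_sqrt[OF ip_positive])
  have abs_sq: "square (cstar_abs c) = star c * c" for c :: 'a
    unfolding cstar_abs_def by (rule square_positive_sqrt[OF positive_star_mult])
  let ?cov = "weighted_covariance ip p {1..n}"
  define G where "G = (\<Sum>i=1..n. p i *\<^sub>R ip (x i - a) (x i - a))"
  define H where "H = (\<Sum>i=1..n. p i *\<^sub>R ip (y i - b) (y i - b))"
  define S where "S = (\<Sum>i=1..n. p i * (module_norm ip (x i - a))\<^sup>2)"
  have cov_x: "?cov x x = G - ip ((\<Sum>i=1..n. p i *\<^sub>R x i) - a) ((\<Sum>i=1..n. p i *\<^sub>R x i) - a)"
    and cov_y: "?cov y y = H - ip ((\<Sum>i=1..n. p i *\<^sub>R y i) - b) ((\<Sum>i=1..n. p i *\<^sub>R y i) - b)"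
    unfolding G_def H_def by (rule weighted_covariance_translate[OF p1, symmetric])+
  have pos_x: "positive (?cov x x)" and pos_y: "positive (?cov y y)"
    by (intro positive_weighted_covariance p0 p1; assumption)+
  have sa: "selfadjoint (?cov y y)" "selfadjoint H"
    using pos_y positive_sum[of "{1..n}" "\<lambda>i. p i *\<^sub>R ip (y i - b) (y i - b)"]
    by (simp_all add: H_def positive_def[of "?cov y y"] positive_imp_selfadjoint positive_scaleR ip_positive p0)
  have "norm (?cov x x) \<le> norm G"
    by (rule positive_norm_mono[OF pos_x]) (simp only: cov_x diff_diff_eq2 add_diff_cancel_left' ip_positive)
  also have "\<dots> \<le> S" unfolding G_def S_def module_norm_def
    by (rule sum_norm_le) (simp add: p0)
  finally have NS: "norm (?cov x x) \<le> S" .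
  have "S *\<^sub>R H - norm (?cov x x) *\<^sub>R ?cov y y
      = S *\<^sub>R (H - ?cov y y) + (S - norm (?cov x x)) *\<^sub>R ?cov y y"
    by (simp add: scaleR_right_diff_distrib scaleR_left_diff_distrib)
  also have "positive \<dots>"
    using NS norm_ge_zero[of "?cov x x"]
    by (intro positive_add positive_scaleR pos_y)
       (simp_all only: cov_y diff_diff_eq2 add_diff_cancel_left' ip_positive diff_ge_0_iff_ge order_trans)
  finally have second: "positive (S *\<^sub>R H - norm (?cov x x) *\<^sub>R ?cov y y)" .
  show ?thesis
    unfolding mod_sq abs_sq S_def[symmetric] G_def[symmetric] H_def[symmetric]
      cov_x[symmetric] cov_y[symmetric] weighted_covariance_def[symmetric] cstar_le_def
    using second sa weighted_covariance_cauchy_schwarz[OF p0 p1, of x y]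
    by (auto simp: selfadjoint_scaleR selfadjoint_star_mult)
qed

end
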